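(* Let $A$ be a $d\times n$ integer matrix, let $\mathcal{K}\subseteq\mathbb{R}^n$ be a maximal cone of the Gröbner fan of $A$, with associated (proper) monomial ideal $M$, and let $$\mathcal{G}=\bigl\{(c,t)\in\mathbb{R}^{n+1} : c\in\mathcal{K}\ \text{and}\ c\cdot(u-v_{u,\tau})\le t\ \text{ for every irreducible component } I(u,\tau)\text{ of } M\bigr\}.$$ Then the projection onto $\mathcal{K}$ of the lower envelope of the polyhedral cone $\mathcal{G}$ is a polyhedral subdivision of $\mathcal{K}$, and the gap function $c\mapsto\mathrm{gap}(A,c)$ is linear on each face of this subdivision.
   Context: For $c\in\mathbb{R}^n$ and $b\in\mathbb{Z}^d$, the integer program is: minimize $c\cdot u$ subject to $Au=b$, $u\ge0$, $u\in\mathbb{Z}^n$; its linear relaxation is obtained by replacing $u\in\mathbb{Z}^n$ by $u\in\mathbb{R}^n$. $\mathrm{gap}(A,c)$ is the maximum of (optimal value of the integer program) $-$ (optimal value of its relaxation), over all $b$ for which the integer program is feasible and bounded. A vector $u\in\mathbb{N}^n$ is non-optimal if it is not an optimal solution of the integer program with $b=Au$; $M(A,c)\subseteq\mathbb{R}[x_1,\dots,x_n]$ is the ideal generated by all monomials $x^u$ with $u$ non-optimal. The Gröbner fan of $A$ is the coarsest polyhedral fan in $\mathbb{R}^n$ on which the map $c\mapsto M(A,c)$ is constant (on relative interiors of cones). For a maximal cone $\mathcal{K}$, $M$ denotes the monomial ideal such that $M(A,c)=M$ for all $c$ in the interior of $\mathcal{K}$; $\mathcal{K}$ is the closure of $\{c\in\mathbb{R}^n: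 M(A,c)=M\}$. For $\tau=\{i_1,\dots,i_r\}\subseteq\{1,\dots,n\}$ and $u\in\mathbb{N}^n$ with $u_j=0$ for $j\notin\tau$, $I(u,\tau)=\langle x_{i_1}^{u_{i_1}+1},\dots,x_{i_r}^{u_{i_r}+1}\rangle$. The irreducible components of $M$ are the ideals of this form in its unique irredundant decomposition as an intersection of such ideals. For each irreducible component $I(u,\tau)$ of $M$, $v_{u,\tau}\in\mathbb{R}^n$ denotes the optimal solution of the linear program: maximize $c\cdot u-c\cdot v$ subject to $Av=Au$ and $v_i\ge0$ for all $i\in\tau$ (other coordinates of $v$ unrestricted in sign); this optimal solution does not change as $c$ varies in (the interior of) $\mathcal{K}$. The lower envelope of $\mathcal{G}$ is the polyhedral complex of those faces of $\mathcal{G}$ that are visible from below in the $t$-direction, i.e. the set of points $(c,t)\in\mathcal{G}$ with $t$ minimal for the given $c$; the projection is $(c,t)\mapsto c$. *)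

theory Defs
  imports "HOL-Analysis.Analysis" "HOL-Library.Poly_Mapping"
begin

definition real_vec :: "int ^ 'n \<Rightarrow> real ^ 'n" where
  "real_vec x = (\<chi> i. real_of_int (x $ i))"

definition real_mat :: "int ^ 'n ^ 'd \<Rightarrow> real ^ 'n ^ 'd" where
  "real_mat A = (\<chi> i j. real_of_int (A $ i $ j))"

text \<open>Exponent vectors, i.e. elements of \<open>\<nat>\<^sup>n\<close>, have type \<open>'n \<Rightarrow>\<^sub>0 nat\<close>, and the polynomial ring
  \<open>\<real>[x\<^sub>1, \<dots>, x\<^sub>n]\<close> is the type \<open>('n \<Rightarrow>\<^sub>0 nat) \<Rightarrow>\<^sub>0 real\<close> with convolution product.\<close>

definition int_vec :: "('n \<Rightarrow>\<^sub>0 nat) \<Rightarrow> int ^ 'n" where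
  "int_vec u = (\<chi> i. int (Poly_Mapping.lookup u i))"


subsection \<open>The integer program, its relaxation and the gap\<close>

definition ip_feasible :: "int ^ 'n ^ 'd \<Rightarrow> int ^ 'd \<Rightarrow> (int ^ 'n) set" where
  "ip_feasible A b = {u. A *v u = b \<and> (\<forall>i. 0 \<le> u $ i)}"

definition lp_feasible :: "int ^ 'n ^ 'd \<Rightarrow> int ^ 'd \<Rightarrow> (real ^ 'n) set" where
  "lp_feasible A b = {u. real_mat A *v u = real_vec b \<and> (\<forall>i. 0 \<le> u $ i)}"

definition ip_value :: "int ^ 'n ^ 'd \<Rightarrow> real ^ 'n \<Rightarrow> int ^ 'd \<Rightarrow> real" where
  "ip_value A c b = (INF u\<in>ip_feasible A b. c \<bullet> real_vec u)"

definition lp_value :: "int ^ 'n ^ 'd \<Rightarrow> real ^ 'n \<Rightarrow> int ^ 'd \<Rightarrow> real" where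
  "lp_value A c b = (INF u\<in>lp_feasible A b. c \<bullet> u)"

definition ip_feasible_bounded :: "int ^ 'n ^ 'd \<Rightarrow> real ^ 'n \<Rightarrow> int ^ 'd \<Rightarrow> bool" where
  "ip_feasible_bounded A c b \<longleftrightarrow>
     ip_feasible A b \<noteq> {} \<and> bdd_below ((\<lambda>u. c \<bullet> real_vec u) ` ip_feasible A b)"

definition gap :: "int ^ 'n ^ 'd \<Rightarrow> real ^ 'n \<Rightarrow> real" where
  "gap A c = (GREATEST g. \<exists>b. ip_feasible_bounded A c b \<and> g = ip_value A c b - lp_value A c b)"


subsection \<open>Monomial ideals\<close>

definition monomial :: "('n \<Rightarrow>\<^sub>0 nat) \<Rightarrow> (('n \<Rightarrow>\<^sub>0 nat) \<Rightarrow>\<^sub>0 real)" where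
  "monomial u = Poly_Mapping.single u 1"

text \<open>An ideal is a submodule of the ring, regarded as a module over itself.\<close>

definition generated_ideal ::
    "(('n \<Rightarrow>\<^sub>0 nat) \<Rightarrow>\<^sub>0 real) set \<Rightarrow> (('n \<Rightarrow>\<^sub>0 nat) \<Rightarrow>\<^sub>0 real) set" where
  "generated_ideal S = module.span (*) S"

definition ip_optimal :: "int ^ 'n ^ 'd \<Rightarrow> real ^ 'n \<Rightarrow> ('n \<Rightarrow>\<^sub>0 nat) \<Rightarrow> bool" where
  "ip_optimal A c u \<longleftrightarrow>
     (\<forall>v\<in>ip_feasible A (A *v int_vec u). c \<bullet> real_vec (int_vec u) \<le> c \<bullet> real_vec v)"

definition nonopt_ideal :: "int ^ 'n ^ 'd \<Rightarrow> real ^ 'n \<Rightarrow> (('n \<Rightarrow>\<^sub>0 nat) \<Rightarrow>\<^sub>0 real) set" where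
  "nonopt_ideal A c = generated_ideal (monomial ` {u. \<not> ip_optimal A c u})"

definition irr_ideal :: "('n \<Rightarrow>\<^sub>0 nat) \<Rightarrow> 'n set \<Rightarrow> (('n \<Rightarrow>\<^sub>0 nat) \<Rightarrow>\<^sub>0 real) set" where
  "irr_ideal u \<tau> =
     generated_ideal
       ((\<lambda>i. monomial (Poly_Mapping.single i (Poly_Mapping.lookup u i + 1))) ` \<tau>)"

definition irredundant_decomposition ::
    "(('n \<Rightarrow>\<^sub>0 nat) \<Rightarrow>\<^sub>0 real) set \<Rightarrow> (('n \<Rightarrow>\<^sub>0 nat) \<Rightarrow>\<^sub>0 real) set set \<Rightarrow> bool" where
  "irredundant_decomposition M Q \<longleftrightarrow>
     finite Q \<and> (\<forall>I\<in>Q. \<exists>u \<tau>. Poly_Mapping.keys u \<subseteq> \<tau> \<and> I = irr_ideal u \<tau>) \<and>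
     \<Inter>Q = M \<and> (\<forall>I\<in>Q. \<Inter>(Q - {I}) \<noteq> M)"

text \<open>The pair \<open>(u, \<tau>)\<close> is determined by the ideal \<open>I(u, \<tau>)\<close>, so the components
  may be indexed by such pairs.\<close>

definition irr_components ::
    "(('n \<Rightarrow>\<^sub>0 nat) \<Rightarrow>\<^sub>0 real) set \<Rightarrow> (('n \<Rightarrow>\<^sub>0 nat) \<times> 'n set) set" where
  "irr_components M =
     {(u, \<tau>). Poly_Mapping.keys u \<subseteq> \<tau> \<and> irr_ideal u \<tau> \<in> (THE Q. irredundant_decomposition M Q)}"


subsection \<open>Polyhedral complexes and the Groebner fan\<close>

text \<open>Members of a complex are nonempty, whereas \<open>{}\<close> is a face of every set in the sense of
  \<open>(face_of)\<close>; in particular disjoint members are allowed.\<close>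

definition polyhedral_complex :: "'a::euclidean_space set set \<Rightarrow> bool" where
  "polyhedral_complex \<C> \<longleftrightarrow>
     finite \<C> \<and>
     (\<forall>P\<in>\<C>. polyhedron P \<and> P \<noteq> {}) \<and>
     (\<forall>P\<in>\<C>. \<forall>F. F face_of P \<and> F \<noteq> {} \<longrightarrow> F \<in> \<C>) \<and>
     (\<forall>P\<in>\<C>. \<forall>Q\<in>\<C>. (P \<inter> Q) face_of P \<and> (P \<inter> Q) face_of Q)"

definition polyhedral_subdivision :: "'a::euclidean_space set set \<Rightarrow> 'a set \<Rightarrow> bool" where
  "polyhedral_subdivision \<C> K \<longleftrightarrow> polyhedral_complex \<C> \<and> \<Union>\<C> = K"

text \<open>Cones of a fan may contain lines.\<close>

definition polyhedral_fan :: "'a::euclidean_space set set \<Rightarrow> bool" where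
  "polyhedral_fan \<F> \<longleftrightarrow> polyhedral_complex \<F> \<and> (\<forall>C\<in>\<F>. cone C)"

text \<open>If the integer program with cost \<open>c\<close> is unbounded (for one, equivalently every, feasible right-hand
  side), then no \<open>u\<close> is optimal and the ideal is the whole ring. The support of the fan is the set of
  the remaining \<open>c\<close>; it is all of \<open>\<real>\<^sup>n\<close> if \<open>0\<close> is the only nonnegative vector in the kernel
  of \<open>A\<close>.\<close>

definition constant_ideal_fan :: "int ^ 'n ^ 'd \<Rightarrow> (real ^ 'n) set set \<Rightarrow> bool" where
  "constant_ideal_fan A \<F> \<longleftrightarrow>
     polyhedral_fan \<F> \<and>
     \<Union>\<F> = {c. nonopt_ideal A c \<noteq> UNIV} \<and>
     (\<forall>C\<in>\<F>. \<forall>c\<in>rel_interior C. \<forall>c'\<in>rel_interior C. nonopt_ideal A c = nonopt_ideal A c')"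

definition is_groebner_fan :: "int ^ 'n ^ 'd \<Rightarrow> (real ^ 'n) set set \<Rightarrow> bool" where
  "is_groebner_fan A \<F> \<longleftrightarrow>
     constant_ideal_fan A \<F> \<and>
     (\<forall>\<F>'. constant_ideal_fan A \<F>' \<longrightarrow> (\<forall>C'\<in>\<F>'. \<exists>C\<in>\<F>. C' \<subseteq> C))"

definition maximal_cone :: "'a set \<Rightarrow> 'a set set \<Rightarrow> bool" where
  "maximal_cone K \<F> \<longleftrightarrow> K \<in> \<F> \<and> (\<forall>C\<in>\<F>. K \<subseteq> C \<longrightarrow> C = K)"


subsection \<open>The cone over a maximal cone and its lower envelope\<close>

definition relaxed_feasible ::
    "int ^ 'n ^ 'd \<Rightarrow> ('n \<Rightarrow>\<^sub>0 nat) \<Rightarrow> 'n set \<Rightarrow> (real ^ 'n) set" where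
  "relaxed_feasible A u \<tau> =
     {v. real_mat A *v v = real_mat A *v real_vec (int_vec u) \<and> (\<forall>i\<in>\<tau>. 0 \<le> v $ i)}"

definition relaxed_optimal ::
    "int ^ 'n ^ 'd \<Rightarrow> real ^ 'n \<Rightarrow> ('n \<Rightarrow>\<^sub>0 nat) \<Rightarrow> 'n set \<Rightarrow> real ^ 'n \<Rightarrow> bool" where
  "relaxed_optimal A c u \<tau> v \<longleftrightarrow>
     v \<in> relaxed_feasible A u \<tau> \<and>
     (\<forall>w\<in>relaxed_feasible A u \<tau>.
        c \<bullet> real_vec (int_vec u) - c \<bullet> w \<le> c \<bullet> real_vec (int_vec u) - c \<bullet> v)"

definition opt_vertex ::
    "int ^ 'n ^ 'd \<Rightarrow> (real ^ 'n) set \<Rightarrow> ('n \<Rightarrow>\<^sub>0 nat) \<Rightarrow> 'n set \<Rightarrow> real ^ 'n" where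
  "opt_vertex A K u \<tau> = (THE v. \<forall>c\<in>interior K. relaxed_optimal A c u \<tau> v)"

definition gap_cone ::
    "int ^ 'n ^ 'd \<Rightarrow> (real ^ 'n) set \<Rightarrow> (('n \<Rightarrow>\<^sub>0 nat) \<Rightarrow>\<^sub>0 real) set \<Rightarrow> ((real ^ 'n) \<times> real) set" where
  "gap_cone A K M =
     {(c, t). c \<in> K \<and>
        (\<forall>(u, \<tau>)\<in>irr_components M. c \<bullet> (real_vec (int_vec u) - opt_vertex A K u \<tau>) \<le> t)}"

definition lower_envelope :: "('a::euclidean_space \<times> real) set \<Rightarrow> ('a \<times> real) set set" where
  "lower_envelope G =
     {F. F face_of G \<and> F \<noteq> {} \<and> (\<forall>(c, t)\<in>F. \<forall>t'. (c, t') \<in> G \<longrightarrow> t \<le> t')}"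

definition projected_envelope :: "('a::euclidean_space \<times> real) set \<Rightarrow> 'a set set" where
  "projected_envelope G = (\<lambda>F. fst ` F) ` lower_envelope G"

end

theory Submission
  imports Defs
begin

text \<open>
  The theorem follows from one formula. For every \<open>c\<close> in \<open>\<K>\<close>, boundary included, \<open>gap(A,c)\<close> is
  the maximum of the numbers \<open>c \<bullet> (u - v)\<close>, where \<open>(u, \<tau>)\<close> runs over the irreducible components of
  \<open>M\<close> and \<open>v\<close> is the optimal vertex attached to \<open>(u, \<tau>)\<close> (lemma \<open>gap_eq_max\<close>). There are finitely
  many components, so \<open>\<G>\<close> is the epigraph over the polyhedron \<open>\<K>\<close> of a maximum of finitely many linear
  functions. Each face of its lower envelope lies in the graph of one of these functions, hence
  projects isomorphically into \<open>\<K>\<close>, and faces and intersections can be transported along the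
  projection (\<open>projected_envelope_max\<close>).

  Why the formula holds. A monomial lies outside \<open>M\<close> exactly if its exponent \<open>w\<close> is an optimal
  solution, for one or equivalently for all costs in the interior of \<open>\<K>\<close>; and \<open>w\<close> lies outside
  \<open>M\<close> exactly if \<open>w \<le> u\<close> on \<open>\<tau>\<close> for some component \<open>(u, \<tau>)\<close>. If \<open>w\<close> is optimal for the right-hand
  side \<open>b\<close> and \<open>x\<close> is feasible for the relaxation, then \<open>x + (u - w)\<close> is feasible for the linear
  program of that component, so \<open>c \<bullet> w - c \<bullet> x \<le> c \<bullet> u - c \<bullet> v\<close>. Conversely, adding a large integer
  to the coordinates outside \<open>\<tau>\<close> of both \<open>u\<close> and \<open>v\<close> keeps \<open>u\<close> optimal and makes \<open>v\<close>
  nonnegative, so the value \<open>c \<bullet> (u - v)\<close> is attained. Costs on the boundary of \<open>\<K>\<close> are limits of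
  interior ones, and all the inequalities involved are closed.

  Three facts make the objects in this formula well defined. First, the irredundant irreducible
  decomposition of a monomial ideal exists and is unique: existence comes from Dickson's lemma and
  uniqueness from the fact that an irreducible ideal containing a finite intersection of monomial
  ideals contains one of them. Second, the optimal vertex of a component does not depend on
  \<open>c\<close>: optimality of \<open>v\<close> says that a certain set of integer points consists of optimal solutions,
  and the latter is visible in \<open>M\<close> (\<open>relaxed_optimal_iff\<close>, \<open>recession_nonneg_iff_optimal\<close>). The
  passage from integer to real directions in this argument is made by simultaneous Diophantine
  approximation (\<open>integral_kernel_direction\<close>). Third, \<open>\<K>\<close> has nonempty interior, because
  the cones of the fan cover a convex set with nonempty interior.
\<close>

section \<open>Monomial ideals and irreducible decompositions\<close>

interpretation poly_module: module "(*) :: (('n \<Rightarrow>\<^sub>0 nat) \<Rightarrow>\<^sub>0 real) \<Rightarrow> _"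
  by unfold_locales (simp_all add: algebra_simps)

text \<open>The polynomials with all exponents above \<open>S\<close> form an ideal containing the generators. Conversely, each
  term of such a polynomial is a multiple of a generator.\<close>

lemma mem_generated_ideal_monomials:
  "p \<in> generated_ideal (monomial ` S) \<longleftrightarrow>
     (\<forall>w\<in>Poly_Mapping.keys p. \<exists>s\<in>S. \<forall>i. Poly_Mapping.lookup s i \<le> Poly_Mapping.lookup w i)"
proof
  let ?above = "\<lambda>w. \<exists>s\<in>S. \<forall>i. Poly_Mapping.lookup s i \<le> Poly_Mapping.lookup w i"
  let ?T = "{p :: ('a \<Rightarrow>\<^sub>0 nat) \<Rightarrow>\<^sub>0 real. \<forall>w\<in>Poly_Mapping.keys p. ?above w}"
  have "poly_module.subspace ?T"
  proof (rule poly_module.subspaceI)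
    fix p q :: "('a \<Rightarrow>\<^sub>0 nat) \<Rightarrow>\<^sub>0 real"
    assume "p \<in> ?T" "q \<in> ?T"
    then show "p + q \<in> ?T"
      using keys_add[of p q] by blast
  next
    fix r p :: "('a \<Rightarrow>\<^sub>0 nat) \<Rightarrow>\<^sub>0 real"
    assume p: "p \<in> ?T"
    have "?above w" if w: "w \<in> Poly_Mapping.keys (r * p)" for w
    proof -
      obtain a b where "w = a + b" "b \<in> Poly_Mapping.keys p"
        using subsetD[OF keys_mult w] by blast
      moreover obtain s where "s \<in> S" "\<forall>i. Poly_Mapping.lookup s i \<le> Poly_Mapping.lookup b i"
        using p \<open>b \<in> Poly_Mapping.keys p\<close> by blast
      ultimately show ?thesis
        by (intro bexI[of _ s]) (simp_all add: lookup_add trans_le_add2)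
    qed
    then show "r * p \<in> ?T" by blast
  qed simp
  moreover have "monomial ` S \<subseteq> ?T"
    by (auto simp: monomial_def)
  ultimately show "\<forall>w\<in>Poly_Mapping.keys p. ?above w"
    if "p \<in> generated_ideal (monomial ` S)"
    using poly_module.span_minimal that unfolding generated_ideal_def by blast
next
  assume above: "\<forall>w\<in>Poly_Mapping.keys p. \<exists>s\<in>S. \<forall>i. Poly_Mapping.lookup s i \<le> Poly_Mapping.lookup w i"
  have "Poly_Mapping.single w (Poly_Mapping.lookup p w) \<in> poly_module.span (monomial ` S)"
    if w: "w \<in> Poly_Mapping.keys p" for w
  proof -
    obtain s where s: "s \<in> S" "\<forall>i. Poly_Mapping.lookup s i \<le> Poly_Mapping.lookup w i"
      using above w by blast
    have "(w - s) + s = w"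
      using s(2) by (intro poly_mapping_eqI) (simp add: lookup_add lookup_minus)
    then have "Poly_Mapping.single w (Poly_Mapping.lookup p w) =
        Poly_Mapping.single (w - s) (Poly_Mapping.lookup p w) * monomial s"
      by (simp add: monomial_def mult_single)
    then show ?thesis
      using poly_module.span_scale[OF poly_module.span_base[OF imageI[OF s(1)]]] by simp
  qed
  then have "(\<Sum>w\<in>Poly_Mapping.keys p. Poly_Mapping.single w (Poly_Mapping.lookup p w))
      \<in> poly_module.span (monomial ` S)"
    by (intro poly_module.span_sum) blast
  moreover have "(\<Sum>w\<in>Poly_Mapping.keys p. Poly_Mapping.single w (Poly_Mapping.lookup p w)) = p"
  proof (rule poly_mapping_eqI)
    fix v
    have "(\<Sum>w\<in>Poly_Mapping.keys p. Poly_Mapping.lookup (Poly_Mapping.single w (Poly_Mapping.lookup p w)) v)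
        = (\<Sum>w\<in>Poly_Mapping.keys p. if w = v then Poly_Mapping.lookup p v else 0)"
      by (rule sum.cong) (simp_all add: lookup_single when_def)
    also have "\<dots> = Poly_Mapping.lookup p v"
      by (simp add: in_keys_iff)
    finally show "Poly_Mapping.lookup (\<Sum>w\<in>Poly_Mapping.keys p.
        Poly_Mapping.single w (Poly_Mapping.lookup p w)) v = Poly_Mapping.lookup p v"
      by (simp only: lookup_sum)
  qed
  ultimately show "p \<in> generated_ideal (monomial ` S)"
    by (simp add: generated_ideal_def)
qed

lemma monomial_mem_generated_ideal:
  "monomial w \<in> generated_ideal (monomial ` S) \<longleftrightarrow>
     (\<exists>s\<in>S. \<forall>i. Poly_Mapping.lookup s i \<le> Poly_Mapping.lookup w i)"
  by (simp add: mem_generated_ideal_monomials monomial_def[of w])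

text \<open>Sets of this kind are determined by the monomials that they contain, so that statements about
  them become statements about sets of exponent vectors.\<close>

definition monomial_ideal :: "(('n \<Rightarrow>\<^sub>0 nat) \<Rightarrow>\<^sub>0 real) set \<Rightarrow> bool" where
  "monomial_ideal I \<longleftrightarrow> (\<forall>p. p \<in> I \<longleftrightarrow> (\<forall>w\<in>Poly_Mapping.keys p. monomial w \<in> I))"

lemma monomial_ideal_generated: "monomial_ideal (generated_ideal (monomial ` S))"
  unfolding monomial_ideal_def monomial_mem_generated_ideal
  by (simp add: mem_generated_ideal_monomials)

lemma monomial_ideal_subset_iff:
  assumes "monomial_ideal I" "monomial_ideal J"
  shows "I \<subseteq> J \<longleftrightarrow> (\<forall>w. monomial w \<in> I \<longrightarrow> monomial w \<in> J)"
  using assms unfolding monomial_ideal_def by blast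

lemma monomial_ideal_eq_iff:
  assumes "monomial_ideal I" "monomial_ideal J"
  shows "I = J \<longleftrightarrow> (\<forall>w. monomial w \<in> I \<longleftrightarrow> monomial w \<in> J)"
  using monomial_ideal_subset_iff[OF assms] monomial_ideal_subset_iff[OF assms(2,1)] by blast

lemma monomial_ideal_Inter:
  assumes "\<And>I. I \<in> Q \<Longrightarrow> monomial_ideal I"
  shows "monomial_ideal (\<Inter>Q)"
  using assms unfolding monomial_ideal_def by blast

lemma irr_ideal_alt:
  "irr_ideal u \<tau> = generated_ideal
     (monomial ` (\<lambda>i. Poly_Mapping.single i (Poly_Mapping.lookup u i + 1)) ` \<tau>)"
  by (simp add: irr_ideal_def image_image)

lemma monomial_mem_irr_ideal:
  "monomial w \<in> irr_ideal u \<tau> \<longleftrightarrow> (\<exists>i\<in>\<tau>. Poly_Mapping.lookup u i < Poly_Mapping.lookup w i)"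
proof -
  have "(\<forall>j. Poly_Mapping.lookup (Poly_Mapping.single i (Poly_Mapping.lookup u i + 1)) j
          \<le> Poly_Mapping.lookup w j) \<longleftrightarrow> Poly_Mapping.lookup u i < Poly_Mapping.lookup w i" for i
    by (auto simp: lookup_single when_def)
  then show ?thesis
    by (simp add: irr_ideal_alt monomial_mem_generated_ideal)
qed

lemma monomial_ideal_irr_ideal: "monomial_ideal (irr_ideal u \<tau>)"
  by (simp add: irr_ideal_alt monomial_ideal_generated)

text \<open>The pure powers in \<open>I(u, \<tau>)\<close> are the \<open>x\<^sub>i\<^sup>k\<close> with \<open>i \<in> \<tau>\<close> and \<open>k > u\<^sub>i\<close>; they show both \<open>\<tau>\<close> and
  the entries of \<open>u\<close> on \<open>\<tau>\<close>.\<close>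

lemma irr_ideal_inj:
  assumes "irr_ideal u \<tau> = irr_ideal u' \<tau>'"
    and "Poly_Mapping.keys u \<subseteq> \<tau>" "Poly_Mapping.keys u' \<subseteq> \<tau>'"
  shows "u = u' \<and> \<tau> = \<tau>'"
proof -
  have pure_power: "monomial (Poly_Mapping.single i k) \<in> irr_ideal v \<sigma> \<longleftrightarrow>
      i \<in> \<sigma> \<and> Poly_Mapping.lookup v i < k" for i k and v :: "'a \<Rightarrow>\<^sub>0 nat" and \<sigma>
    by (auto simp: monomial_mem_irr_ideal lookup_single when_def split: if_splits)
  have eq: "i \<in> \<tau> \<and> Poly_Mapping.lookup u i < k \<longleftrightarrow> i \<in> \<tau>' \<and> Poly_Mapping.lookup u' i < k" for i k
    using assms(1) pure_power by metis
  then have "\<tau> = \<tau>'"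
    by (metis less_irrefl lessI linorder_neqE_nat less_trans subsetI subset_antisym)
  moreover have "Poly_Mapping.lookup u i = Poly_Mapping.lookup u' i" for i
  proof (cases "i \<in> \<tau>")
    case True
    then show ?thesis
      using eq[of i] \<open>\<tau> = \<tau>'\<close> by (metis linorder_neqE_nat less_irrefl)
  next
    case False
    then show ?thesis
      using assms(2,3) \<open>\<tau> = \<tau>'\<close> by (metis in_keys_iff subsetD)
  qed
  ultimately show ?thesis
    by (simp add: poly_mapping_eqI)
qed

text \<open>Dickson's lemma, for a family of vectors so that it covers exponents as well as nonnegative integer
  points. For the induction on the number of coordinates, take a finite set \<open>B\<close> that serves
  for the old coordinates and let \<open>m\<close> be its largest new coordinate. Then \<open>B\<close> still serves for the elements
  whose new coordinate is at least \<open>m\<close>, and the others fall into \<open>m\<close> classes on which the new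
  coordinate is constant.\<close>

lemma Dickson:
  fixes f :: "'a \<Rightarrow> 'i \<Rightarrow> nat"
  assumes "finite X"
  shows "\<exists>B. finite B \<and> B \<subseteq> S \<and> (\<forall>s\<in>S. \<exists>b\<in>B. \<forall>i\<in>X. f b i \<le> f s i)"
  using assms
proof (induction X arbitrary: S)
  case empty
  show ?case
  proof (cases "S = {}")
    case False
    then obtain s where "s \<in> S" by blast
    then show ?thesis by (intro exI[of _ "{s}"]) auto
  qed auto
next
  case (insert x X)
  obtain B where B: "finite B" "B \<subseteq> S" "\<forall>s\<in>S. \<exists>b\<in>B. \<forall>i\<in>X. f b i \<le> f s i"
    using insert.IH[of S] by blast
  define m where "m = Max (insert 0 ((\<lambda>b. f b x) ` B))"
  have m: "f b x \<le> m" if "b \<in> B" for b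
    using B(1) that by (simp add: m_def)
  define fibre where "fibre k = {s\<in>S. f s x = k}" for k
  have "\<forall>k. \<exists>C. finite C \<and> C \<subseteq> fibre k \<and> (\<forall>s\<in>fibre k. \<exists>b\<in>C. \<forall>i\<in>X. f b i \<le> f s i)"
    by (intro allI insert.IH)
  from choice[OF this] obtain C where "\<forall>k. finite (C k) \<and> C k \<subseteq> fibre k \<and>
      (\<forall>s\<in>fibre k. \<exists>b\<in>C k. \<forall>i\<in>X. f b i \<le> f s i)" ..
  then have C: "\<And>k. finite (C k)" "\<And>k. C k \<subseteq> {s\<in>S. f s x = k}"
    "\<And>k s. s \<in> S \<Longrightarrow> f s x = k \<Longrightarrow> \<exists>b\<in>C k. \<forall>i\<in>X. f b i \<le> f s i"
    by (simp_all add: fibre_def)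
  show ?case
  proof (intro exI[of _ "B \<union> (\<Union>k<m. C k)"] conjI ballI)
    fix s assume s: "s \<in> S"
    show "\<exists>b\<in>B \<union> (\<Union>k<m. C k). \<forall>i\<in>insert x X. f b i \<le> f s i"
    proof (cases "f s x < m")
      case True
      obtain b where b: "b \<in> C (f s x)" "\<forall>i\<in>X. f b i \<le> f s i"
        using C(3)[OF s refl] by blast
      then have "f b x = f s x" using C(2) by blast
      then show ?thesis using b True by (intro bexI[of _ b]) auto
    next
      case False
      obtain b where b: "b \<in> B" "\<forall>i\<in>X. f b i \<le> f s i"
        using B(3) s by blast
      then have "f b x \<le> f s x" using False m[OF b(1)] by simp
      then show ?thesis using b by blast
    qed
  next
    show "finite (B \<union> (\<Union>k<m. C k))" using B(1) C(1) by simp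
    show "B \<union> (\<Union>k<m. C k) \<subseteq> S" using B(2) C(2) by blast
  qed
qed

text \<open>The exponents outside \<open>I(u, \<tau>)\<close> form the box given by \<open>w\<^sub>i \<le> u\<^sub>i\<close> for \<open>i \<in> \<tau>\<close>. A new generator
  \<open>b\<close> removes from each box the exponents above \<open>b\<close>, and what remains is the union of the
  smaller boxes obtained by imposing \<open>w\<^sub>i < b\<^sub>i\<close> for a single \<open>i\<close> in the support of \<open>b\<close>.\<close>

lemma finitely_generated_monomial_ideal_decomposition:
  fixes B :: "('n::finite \<Rightarrow>\<^sub>0 nat) set"
  assumes "finite B"
  shows "\<exists>Q. finite Q \<and> (\<forall>I\<in>Q. \<exists>u \<tau>. Poly_Mapping.keys u \<subseteq> \<tau> \<and> I = irr_ideal u \<tau>) \<and>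
    \<Inter>Q = generated_ideal (monomial ` B)"
  using assms
proof (induction B)
  case empty
  show ?case
  proof (intro exI[of _ "{irr_ideal 0 {}}"] conjI ballI)
    fix I :: "(('n \<Rightarrow>\<^sub>0 nat) \<Rightarrow>\<^sub>0 real) set"
    assume "I \<in> {irr_ideal 0 {}}"
    then show "\<exists>u \<tau>. Poly_Mapping.keys u \<subseteq> \<tau> \<and> I = irr_ideal u \<tau>"
      by (intro exI[of _ 0] exI[of _ "{}"]) simp
  qed (simp_all add: irr_ideal_def)
next
  case (insert b B)
  then obtain Q where Q: "finite Q"
    "\<forall>I\<in>Q. \<exists>u \<tau>. Poly_Mapping.keys u \<subseteq> \<tau> \<and> I = irr_ideal u \<tau>"
    "\<Inter>Q = generated_ideal (monomial ` B)"
    by blast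
  \<comment> \<open>The corner of the smaller box. The coordinate \<open>i\<close> is bounded by \<open>u\<close> only if \<open>i \<in> \<tau>\<close>;
    otherwise the entry of \<open>u\<close> there is meaningless and \<open>b\<^sub>i - 1\<close> is the only bound.\<close>
  define cut :: "('n \<Rightarrow>\<^sub>0 nat) \<Rightarrow> 'n set \<Rightarrow> 'n \<Rightarrow> ('n \<Rightarrow>\<^sub>0 nat)" where
    "cut u \<tau> i = Abs_poly_mapping
       ((Poly_Mapping.lookup u)(i := (if i \<in> \<tau> then min (Poly_Mapping.lookup u i) (Poly_Mapping.lookup b i - 1)
           else Poly_Mapping.lookup b i - 1)))" for u \<tau> i
  have lookup_cut: "Poly_Mapping.lookup (cut u \<tau> i) = (Poly_Mapping.lookup u)
      (i := (if i \<in> \<tau> then min (Poly_Mapping.lookup u i) (Poly_Mapping.lookup b i - 1)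
           else Poly_Mapping.lookup b i - 1))" for u \<tau> i
    by (simp add: cut_def)
  have "\<forall>I\<in>Q. \<exists>p. Poly_Mapping.keys (fst p) \<subseteq> snd p \<and> I = irr_ideal (fst p) (snd p)"
    using Q(2) by simp
  from bchoice[OF this] obtain U where U: "\<And>I. I \<in> Q \<Longrightarrow> Poly_Mapping.keys (fst (U I)) \<subseteq> snd (U I)"
    "\<And>I. I \<in> Q \<Longrightarrow> I = irr_ideal (fst (U I)) (snd (U I))"
    by blast
  define R where "R = (\<lambda>(I, i). irr_ideal (cut (fst (U I)) (snd (U I)) i) (insert i (snd (U I)))) `
    (Q \<times> Poly_Mapping.keys b)"
  have "finite R" using Q(1) by (simp add: R_def)
  moreover have "\<exists>u \<tau>. Poly_Mapping.keys u \<subseteq> \<tau> \<and> I = irr_ideal u \<tau>" if I: "I \<in> R" for I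
  proof -
    obtain J i where J: "J \<in> Q" "I = irr_ideal (cut (fst (U J)) (snd (U J)) i) (insert i (snd (U J)))"
      using I by (auto simp: R_def)
    have "Poly_Mapping.keys (cut (fst (U J)) (snd (U J)) i) \<subseteq> insert i (snd (U J))"
    proof
      fix j assume "j \<in> Poly_Mapping.keys (cut (fst (U J)) (snd (U J)) i)"
      then have "j = i \<or> j \<in> Poly_Mapping.keys (fst (U J))"
        by (simp add: in_keys_iff lookup_cut split: if_splits)
      then show "j \<in> insert i (snd (U J))" using U(1)[OF J(1)] by blast
    qed
    then show ?thesis using J(2) by blast
  qed
  moreover have "\<Inter>R = generated_ideal (monomial ` insert b B)"
  proof -
    have "monomial_ideal (\<Inter>R)"
      by (rule monomial_ideal_Inter) (auto simp: R_def monomial_ideal_irr_ideal)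
    moreover have "monomial w \<in> \<Inter>R \<longleftrightarrow> monomial w \<in> generated_ideal (monomial ` insert b B)" for w
    proof -
      let ?w = "Poly_Mapping.lookup w"
      have irr: "monomial w \<in> irr_ideal (cut (fst (U I)) (snd (U I)) i) (insert i (snd (U I))) \<longleftrightarrow>
          monomial w \<in> I \<or> Poly_Mapping.lookup b i \<le> ?w i"
        if "I \<in> Q" "i \<in> Poly_Mapping.keys b" for I i
      proof -
        have "0 < Poly_Mapping.lookup b i" using that(2) by (simp add: in_keys_iff)
        then have at_i: "Poly_Mapping.lookup (cut (fst (U I)) (snd (U I)) i) i < ?w i \<longleftrightarrow>
            i \<in> snd (U I) \<and> Poly_Mapping.lookup (fst (U I)) i < ?w i \<or> Poly_Mapping.lookup b i \<le> ?w i"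
          by (auto simp: lookup_cut min_def)
        have split: "(\<exists>j\<in>snd (U I). P j) \<longleftrightarrow>
            i \<in> snd (U I) \<and> P i \<or> (\<exists>j\<in>snd (U I). j \<noteq> i \<and> P j)" for P
          by metis
        have "monomial w \<in> irr_ideal (cut (fst (U I)) (snd (U I)) i) (insert i (snd (U I))) \<longleftrightarrow>
            Poly_Mapping.lookup (cut (fst (U I)) (snd (U I)) i) i < ?w i \<or>
            (\<exists>j\<in>snd (U I). j \<noteq> i \<and> Poly_Mapping.lookup (fst (U I)) j < ?w j)"
          unfolding monomial_mem_irr_ideal by (auto simp: lookup_cut)
        then have "monomial w \<in> irr_ideal (cut (fst (U I)) (snd (U I)) i) (insert i (snd (U I))) \<longleftrightarrow>
          monomial w \<in> irr_ideal (fst (U I)) (snd (U I)) \<or> Poly_Mapping.lookup b i \<le> ?w i"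
          unfolding monomial_mem_irr_ideal at_i
            split[of "\<lambda>j. Poly_Mapping.lookup (fst (U I)) j < ?w j"] by blast
        then show ?thesis by (simp only: U(2)[OF that(1), symmetric])
      qed
      have "monomial w \<in> \<Inter>R \<longleftrightarrow>
          (\<forall>I\<in>Q. \<forall>i\<in>Poly_Mapping.keys b. monomial w \<in> I \<or> Poly_Mapping.lookup b i \<le> ?w i)"
        using irr by (auto simp: R_def)
      also have "\<dots> \<longleftrightarrow> monomial w \<in> \<Inter>Q \<or> (\<forall>i\<in>Poly_Mapping.keys b. Poly_Mapping.lookup b i \<le> ?w i)"
        by blast
      also have "(\<forall>i\<in>Poly_Mapping.keys b. Poly_Mapping.lookup b i \<le> ?w i) \<longleftrightarrow> (\<forall>i. Poly_Mapping.lookup b i \<le> ?w i)"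
        by (metis in_keys_iff le0)
      finally show ?thesis
        unfolding Q(3) monomial_mem_generated_ideal by blast
    qed
    ultimately show ?thesis
      by (simp only: monomial_ideal_eq_iff[OF _ monomial_ideal_generated] simp_thms)
  qed
  ultimately show ?case by (intro exI[of _ R] conjI ballI)
qed

text \<open>If every \<open>J\<close> contained a monomial outside \<open>I(u, \<tau>)\<close>, then the least common multiple of
  these monomials would lie in every \<open>J\<close>, but still outside \<open>I(u, \<tau>)\<close> because boxes are
  closed under componentwise maxima.\<close>

lemma Inter_subset_irr_ideal:
  fixes u :: "'n::finite \<Rightarrow>\<^sub>0 nat"
  assumes "finite Q" "\<And>J. J \<in> Q \<Longrightarrow> monomial_ideal J"
    and up: "\<And>J v w. J \<in> Q \<Longrightarrow> monomial v \<in> J \<Longrightarrow>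
      (\<And>i. Poly_Mapping.lookup v i \<le> Poly_Mapping.lookup w i) \<Longrightarrow> monomial w \<in> J"
    and sub: "\<Inter>Q \<subseteq> irr_ideal u \<tau>"
  shows "\<exists>J\<in>Q. J \<subseteq> irr_ideal u \<tau>"
proof (rule ccontr)
  assume none: "\<not> ?thesis"
  have "\<exists>w. monomial w \<in> J \<and> (\<forall>i\<in>\<tau>. Poly_Mapping.lookup w i \<le> Poly_Mapping.lookup u i)"
    if J: "J \<in> Q" for J
  proof -
    have "\<not> J \<subseteq> irr_ideal u \<tau>" using J none by blast
    then show ?thesis
      unfolding monomial_ideal_subset_iff[OF assms(2)[OF J] monomial_ideal_irr_ideal]
        monomial_mem_irr_ideal not_all not_imp bex_simps(8) not_less by simp
  qed
  then have "\<forall>J\<in>Q. \<exists>w. monomial w \<in> J \<and> (\<forall>i\<in>\<tau>. Poly_Mapping.lookup w i \<le> Poly_Mapping.lookup u i)"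
    by blast
  from bchoice[OF this] obtain w where w: "\<And>J. J \<in> Q \<Longrightarrow> monomial (w J) \<in> J"
    "\<And>J i. J \<in> Q \<Longrightarrow> i \<in> \<tau> \<Longrightarrow> Poly_Mapping.lookup (w J) i \<le> Poly_Mapping.lookup u i"
    by blast
  \<comment> \<open>Inserting \<open>0\<close> covers the empty family, whose intersection is the whole ring.\<close>
  define m where "m = Abs_poly_mapping (\<lambda>i. Max (insert 0 ((\<lambda>J. Poly_Mapping.lookup (w J) i) ` Q)))"
  have m: "Poly_Mapping.lookup m i = Max (insert 0 ((\<lambda>J. Poly_Mapping.lookup (w J) i) ` Q))" for i
    by (simp add: m_def)
  have "monomial m \<in> J" if "J \<in> Q" for J
    by (rule up[OF that w(1)[OF that]]) (use that assms(1) in \<open>simp add: m\<close>)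
  then have "monomial m \<in> irr_ideal u \<tau>" using sub by blast
  moreover have "Poly_Mapping.lookup m i \<le> Poly_Mapping.lookup u i" if "i \<in> \<tau>" for i
    using assms(1) w(2) that by (auto simp: m)
  ultimately show False
    by (auto simp: monomial_mem_irr_ideal not_less[symmetric])
qed

lemma irredundant_decompositionD:
  assumes "irredundant_decomposition M Q"
  shows "finite Q" "\<Inter>Q = M"
    "I \<in> Q \<Longrightarrow> \<exists>u \<tau>. Poly_Mapping.keys u \<subseteq> \<tau> \<and> I = irr_ideal u \<tau>"
    "I \<in> Q \<Longrightarrow> \<Inter>(Q - {I}) \<noteq> M"
proof -
  note dec = assms[unfolded irredundant_decomposition_def]
  show "finite Q" "\<Inter>Q = M" using dec by blast+
  show "I \<in> Q \<Longrightarrow> \<exists>u \<tau>. Poly_Mapping.keys u \<subseteq> \<tau> \<and> I = irr_ideal u \<tau>"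
    by (rule bspec[OF conjunct1[OF conjunct2[OF dec]]])
  show "I \<in> Q \<Longrightarrow> \<Inter>(Q - {I}) \<noteq> M"
    by (rule bspec[OF conjunct2[OF conjunct2[OF conjunct2[OF dec]]]])
qed

text \<open>A member \<open>I\<close> of \<open>Q\<close> contains a member \<open>J\<close> of \<open>R\<close>, which contains a member of \<open>Q\<close>; by
  irredundance of \<open>Q\<close> the latter is \<open>I\<close> itself, so that \<open>I = J\<close>.\<close>

lemma irredundant_decomposition_subset:
  fixes M :: "(('n::finite \<Rightarrow>\<^sub>0 nat) \<Rightarrow>\<^sub>0 real) set"
  assumes Q: "irredundant_decomposition M Q" and R: "irredundant_decomposition M R"
  shows "Q \<subseteq> R"
proof
  have dominated: "\<exists>J\<in>Q'. J \<subseteq> I"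
    if Q: "irredundant_decomposition M Q" "I \<in> Q" and Q': "irredundant_decomposition M Q'"
    for Q Q' :: "(('n \<Rightarrow>\<^sub>0 nat) \<Rightarrow>\<^sub>0 real) set set" and I
  proof -
    obtain u \<tau> where I: "I = irr_ideal u \<tau>"
      using irredundant_decompositionD(3)[OF Q] by (elim exE conjE)
    have irr: "\<exists>u \<tau>. J = irr_ideal u \<tau>" if "J \<in> Q'" for J
      using irredundant_decompositionD(3)[OF Q' that] by (elim exE conjE) (intro exI)
    show ?thesis
      unfolding I
    proof (rule Inter_subset_irr_ideal)
      show "finite Q'" by (rule irredundant_decompositionD(1)[OF Q'])
      show "monomial_ideal J" if "J \<in> Q'" for J
        using irr[OF that] by (elim exE) (simp add: monomial_ideal_irr_ideal)
      show "monomial w \<in> J" if "J \<in> Q'" "monomial v \<in> J"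
        "\<And>i. Poly_Mapping.lookup v i \<le> Poly_Mapping.lookup w i" for J v w
        using irr[OF that(1)] that(2,3) by (elim exE) (auto simp: monomial_mem_irr_ideal intro: less_le_trans)
      have "\<Inter>Q' \<subseteq> I"
        using irredundant_decompositionD(2)[OF Q(1)] irredundant_decompositionD(2)[OF Q'] Q(2) by blast
      then show "\<Inter>Q' \<subseteq> irr_ideal u \<tau>"
        by (simp only: I)
    qed
  qed
  fix I assume I: "I \<in> Q"
  obtain J where J: "J \<in> R" "J \<subseteq> I" using dominated[OF Q I R] by blast
  obtain I' where I': "I' \<in> Q" "I' \<subseteq> J" using dominated[OF R J(1) Q] by blast
  have "I' = I"
  proof (rule ccontr)
    assume "I' \<noteq> I"
    then have "\<Inter>(Q - {I}) = \<Inter>Q" using I I' J(2) by blast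
    then show False
      using irredundant_decompositionD(2)[OF Q] irredundant_decompositionD(4)[OF Q I] by simp
  qed
  then have "J = I" using I'(2) J(2) by blast
  then show "I \<in> R" using J(1) by simp
qed

text \<open>A decomposition with the least number of members is irredundant.\<close>

lemma irredundant_decomposition_ex1:
  fixes S :: "('n::finite \<Rightarrow>\<^sub>0 nat) set"
  shows "\<exists>!Q. irredundant_decomposition (generated_ideal (monomial ` S)) Q"
proof -
  let ?M = "generated_ideal (monomial ` S)"
  obtain B where B: "finite B" "B \<subseteq> S"
    "\<forall>s\<in>S. \<exists>b\<in>B. \<forall>i\<in>UNIV. Poly_Mapping.lookup b i \<le> Poly_Mapping.lookup s i"
    using Dickson[of UNIV S Poly_Mapping.lookup] by auto
  have "?M = generated_ideal (monomial ` B)"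
  proof (subst monomial_ideal_eq_iff[OF monomial_ideal_generated monomial_ideal_generated], rule allI)
    fix w
    show "monomial w \<in> ?M \<longleftrightarrow> monomial w \<in> generated_ideal (monomial ` B)"
      unfolding monomial_mem_generated_ideal using B(2,3) by (meson UNIV_I le_trans subsetD)
  qed
  define is_dec where "is_dec Q \<longleftrightarrow> finite Q \<and>
      (\<forall>I\<in>Q. \<exists>u \<tau>. Poly_Mapping.keys u \<subseteq> \<tau> \<and> I = irr_ideal u \<tau>) \<and> \<Inter>Q = ?M" for Q
  have "\<exists>Q. is_dec Q"
    unfolding is_dec_def \<open>?M = generated_ideal (monomial ` B)\<close>
    using finitely_generated_monomial_ideal_decomposition[OF B(1)] by blast
  then obtain Q0 where "is_dec Q0" ..
  define Q where "Q = arg_min card is_dec"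
  have Q: "is_dec Q" "\<And>Q'. is_dec Q' \<Longrightarrow> card Q \<le> card Q'"
    using arg_min_nat_lemma[of is_dec Q0 card] \<open>is_dec Q0\<close> by (simp_all add: Q_def)
  have "\<Inter>(Q - {I}) \<noteq> ?M" if "I \<in> Q" for I
  proof
    assume "\<Inter>(Q - {I}) = ?M"
    then have "is_dec (Q - {I})" using Q(1) by (simp add: is_dec_def)
    then have "card Q \<le> card (Q - {I})" by (rule Q(2))
    moreover have "finite Q" using Q(1) by (simp add: is_dec_def)
    ultimately show False using card_Diff1_less[OF _ that] by simp
  qed
  then have "irredundant_decomposition ?M Q"
    using Q(1) by (simp add: irredundant_decomposition_def is_dec_def)
  then show ?thesis
    by (intro ex1I[of _ Q] subset_antisym irredundant_decomposition_subset)
qed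

text \<open>This is all that the gap formula needs to know about the components: there are finitely many, and
  their boxes together make up the set of exponents outside \<open>M\<close>.\<close>

lemma irr_components_monomial_ideal:
  fixes S :: "('n::finite \<Rightarrow>\<^sub>0 nat) set"
  defines "M \<equiv> generated_ideal (monomial ` S)"
  shows finite_irr_components: "finite (irr_components M)"
    and irr_components_standard: "monomial w \<notin> M \<longleftrightarrow>
      (\<exists>(u, \<tau>)\<in>irr_components M. \<forall>i\<in>\<tau>. Poly_Mapping.lookup w i \<le> Poly_Mapping.lookup u i)"
proof -
  define Q where "Q = (THE Q. irredundant_decomposition M Q)"
  have Q: "irredundant_decomposition M Q"
    unfolding Q_def M_def by (rule theI'[OF irredundant_decomposition_ex1])
  have comps: "irr_components M = {(u, \<tau>). Poly_Mapping.keys u \<subseteq> \<tau> \<and> irr_ideal u \<tau> \<in> Q}"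
    by (simp add: irr_components_def Q_def)
  have "inj_on (\<lambda>(u, \<tau>). irr_ideal u \<tau>) (irr_components M)"
    by (rule inj_onI) (auto simp: comps dest!: irr_ideal_inj)
  moreover have comps_image: "(\<lambda>(u, \<tau>). irr_ideal u \<tau>) ` irr_components M = Q"
  proof
    show "(\<lambda>(u, \<tau>). irr_ideal u \<tau>) ` irr_components M \<subseteq> Q"
      by (auto simp: comps)
    show "Q \<subseteq> (\<lambda>(u, \<tau>). irr_ideal u \<tau>) ` irr_components M"
    proof
      fix I assume I: "I \<in> Q"
      obtain u \<tau> where "Poly_Mapping.keys u \<subseteq> \<tau>" "I = irr_ideal u \<tau>"
        using irredundant_decompositionD(3)[OF Q I] by (elim exE conjE)
      then show "I \<in> (\<lambda>(u, \<tau>). irr_ideal u \<tau>) ` irr_components M"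
        using I by (intro image_eqI[of _ _ "(u, \<tau>)"]) (simp_all add: comps)
    qed
  qed
  ultimately show "finite (irr_components M)"
    using irredundant_decompositionD(1)[OF Q] finite_imageD by fastforce
  have "monomial w \<notin> M \<longleftrightarrow> (\<exists>I\<in>Q. monomial w \<notin> I)"
    using irredundant_decompositionD(2)[OF Q] by blast
  also have "\<dots> \<longleftrightarrow> (\<exists>(u, \<tau>)\<in>irr_components M. monomial w \<notin> irr_ideal u \<tau>)"
    unfolding comps_image[symmetric] by auto
  finally show "monomial w \<notin> M \<longleftrightarrow>
      (\<exists>(u, \<tau>)\<in>irr_components M. \<forall>i\<in>\<tau>. Poly_Mapping.lookup w i \<le> Poly_Mapping.lookup u i)"
    by (simp add: monomial_mem_irr_ideal not_less)
qed

section \<open>Integer programs and their relaxations\<close>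

lemma real_vec_add: "real_vec (x + y) = real_vec x + real_vec y"
  by (simp add: real_vec_def vec_eq_iff)

lemma real_vec_diff: "real_vec (x - y) = real_vec x - real_vec y"
  by (simp add: real_vec_def vec_eq_iff)

lemma real_vec_nth [simp]: "real_vec x $ i = real_of_int (x $ i)"
  by (simp add: real_vec_def)

lemma real_vec_0 [simp]: "real_vec 0 = 0"
  by (simp add: vec_eq_iff)

lemma int_vec_nth [simp]: "int_vec u $ i = int (Poly_Mapping.lookup u i)"
  by (simp add: int_vec_def)

lemma real_mat_real_vec: "real_mat A *v real_vec x = real_vec (A *v x)"
  by (simp add: vec_eq_iff matrix_vector_mult_def real_mat_def)

lemma Dirichlet_approx_vector:
  fixes w :: "real ^ 'n"
  assumes "0 < N"
  obtains q :: int and p :: "int ^ 'n"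
  where "0 < q" "\<And>i. \<bar>of_int q * w $ i - of_int (p $ i)\<bar> < 1 / real N"
proof -
  obtain f :: "'n \<Rightarrow> nat" where f: "bij_betw f UNIV {0..<CARD('n)}"
    using ex_bij_betw_finite_nat[of "UNIV :: 'n set"] by auto
  define g where "g = inv f"
  have g: "g (f i) = i" for i
    using f by (simp add: g_def bij_betw_def)
  obtain q p where q: "0 < q"
    and p: "\<And>k. k < CARD('n) \<Longrightarrow> \<bar>of_int q * w $ g k - of_int (p k)\<bar> < 1 / real N"
    using Dirichlet_approx_simult[OF assms, of "CARD('n)" "\<lambda>k. w $ g k"] by metis
  show thesis
  proof (rule that[of q "\<chi> i. p (f i)"])
    show "\<bar>of_int q * w $ i - of_int ((\<chi> i. p (f i)) $ i)\<bar> < 1 / real N" for i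
    proof -
      have "f i < CARD('n)" using f by (auto simp: bij_betw_def)
      then show ?thesis using p[of "f i"] g[of i] by simp
    qed
  qed (rule q)
qed

text \<open>Dirichlet's theorem gives a multiple \<open>q w\<close> with \<open>q \<ge> 1\<close> that is as close as desired to an integer vector
  \<open>p\<close>. Then \<open>A p\<close> is an integer vector close to \<open>q A w = 0\<close>, hence zero; an entry of \<open>p\<close> close
  to a nonnegative number is greater than \<open>-1\<close>, hence nonnegative; and the strict inequality on the cost
  survives the approximation.\<close>

lemma integral_kernel_direction:
  fixes A :: "int ^ 'n ^ 'd" and c w :: "real ^ 'n"
  assumes ker: "real_mat A *v w = 0" and pos: "\<And>i. i \<in> \<tau> \<Longrightarrow> 0 \<le> w $ i" and neg: "c \<bullet> w < 0"
  obtains p :: "int ^ 'n" where "A *v p = 0" "\<And>i. i \<in> \<tau> \<Longrightarrow> 0 \<le> p $ i" "c \<bullet> real_vec p < 0"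
proof -
  define a where "a = (\<Sum>i\<in>UNIV. \<Sum>j\<in>UNIV. \<bar>real_of_int (A $ i $ j)\<bar>)"
  define s where "s = (\<Sum>j\<in>UNIV. \<bar>c $ j\<bar>)"
  have "0 \<le> a" "0 \<le> s" by (simp_all add: a_def s_def sum_nonneg)
  \<comment> \<open>The error \<open>1 / N\<close> per coordinate costs at most \<open>a / N < 1\<close> in each row of \<open>A\<close> and at
    most \<open>s / N < - (c \<bullet> w)\<close> in the objective.\<close>
  obtain N :: nat where N: "a + s / (- (c \<bullet> w)) + 1 < real N"
    using reals_Archimedean2 by blast
  have "0 \<le> s / (- (c \<bullet> w))" using neg \<open>0 \<le> s\<close> by (simp add: divide_nonneg_neg)
  then have "0 < real N" "a < real N" "s / (- (c \<bullet> w)) < real N"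
    using N \<open>0 \<le> a\<close> by linarith+
  then obtain q and p :: "int ^ 'n" where q: "0 < q"
    and p: "\<And>i. \<bar>of_int q * w $ i - of_int (p $ i)\<bar> < 1 / real N"
    using Dirichlet_approx_vector[of N w] by auto
  define e where "e = real_vec p - of_int q *\<^sub>R w"
  have e: "\<bar>e $ j\<bar> \<le> 1 / real N" for j
    using p[of j] by (simp add: e_def abs_minus_commute)
  have weighted: "\<bar>\<Sum>j\<in>UNIV. k j * e $ j\<bar> \<le> (\<Sum>j\<in>UNIV. \<bar>k j\<bar>) / real N" for k :: "'n \<Rightarrow> real"
  proof -
    have "\<bar>\<Sum>j\<in>UNIV. k j * e $ j\<bar> \<le> (\<Sum>j\<in>UNIV. \<bar>k j * e $ j\<bar>)"
      by (rule sum_abs)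
    also have "\<dots> \<le> (\<Sum>j\<in>UNIV. \<bar>k j\<bar> * (1 / real N))"
      using e by (intro sum_mono) (simp only: abs_mult mult_left_mono abs_ge_zero)
    also have "\<dots> = (\<Sum>j\<in>UNIV. \<bar>k j\<bar>) / real N"
      by (simp only: sum_distrib_right[symmetric]) simp
    finally show ?thesis .
  qed
  have "A *v p = 0"
  proof -
    have "(A *v p) $ i = 0" for i
    proof -
      have "real_mat A *v e = real_vec (A *v p)"
        by (simp add: e_def matrix_vector_mult_diff_distrib real_mat_real_vec
            matrix_vector_mult_scaleR ker)
      then have "real_of_int ((A *v p) $ i) = (real_mat A *v e) $ i"
        by simp
      also have "\<dots> = (\<Sum>j\<in>UNIV. real_of_int (A $ i $ j) * e $ j)"
        by (simp add: matrix_vector_mult_def real_mat_def)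
      finally have "\<bar>real_of_int ((A *v p) $ i)\<bar> \<le> (\<Sum>j\<in>UNIV. \<bar>real_of_int (A $ i $ j)\<bar>) / real N"
        using weighted by simp
      also have "\<dots> \<le> a / real N"
        unfolding a_def
        by (intro divide_right_mono member_le_sum[of i UNIV "\<lambda>i. \<Sum>j\<in>UNIV. \<bar>real_of_int (A $ i $ j)\<bar>"])
          (simp_all add: sum_nonneg)
      also have "\<dots> < 1" using \<open>a < real N\<close> \<open>0 < real N\<close> by simp
      finally show ?thesis by linarith
    qed
    then show ?thesis by (simp add: vec_eq_iff)
  qed
  moreover have "0 \<le> p $ i" if "i \<in> \<tau>" for i
  proof -
    have "0 \<le> of_int q * w $ i" using pos[OF that] q by simp
    moreover have "1 / real N \<le> 1" using \<open>0 < real N\<close> by simp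
    ultimately have "- 1 < real_of_int (p $ i)" using p[of i] by linarith
    then show ?thesis by linarith
  qed
  moreover have "c \<bullet> real_vec p < 0"
  proof -
    have "c \<bullet> e \<le> s / real N"
      using weighted[of "\<lambda>j. c $ j"] by (simp add: inner_vec_def s_def)
    also have "\<dots> < - (c \<bullet> w)"
      using \<open>s / (- (c \<bullet> w)) < real N\<close> neg \<open>0 < real N\<close> by (simp add: field_simps)
    also have "\<dots> \<le> - (of_int q * (c \<bullet> w))"
    proof -
      have "1 \<le> real_of_int q" using q by linarith
      then show ?thesis using neg mult_right_mono_neg[of 1 "real_of_int q" "c \<bullet> w"] by simp
    qed
    finally show ?thesis
      by (simp add: e_def inner_diff_right)
  qed
  ultimately show thesis by (rule that)
qed

text \<open>The directions \<open>w\<close> form the recession cone of the linear program with sign constraints on \<open>\<tau>\<close>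
  only, so this says that every feasible program of this kind is bounded below. For \<open>\<tau> = UNIV\<close>
  it is the condition for \<open>c\<close> to lie in the support of the Groebner fan.\<close>

definition recession_nonneg :: "int ^ 'n ^ 'd \<Rightarrow> real ^ 'n \<Rightarrow> 'n set \<Rightarrow> bool" where
  "recession_nonneg A c \<tau> \<longleftrightarrow>
     (\<forall>w. real_mat A *v w = 0 \<and> (\<forall>i\<in>\<tau>. 0 \<le> w $ i) \<longrightarrow> 0 \<le> c \<bullet> w)"

text \<open>Moves \<open>u\<close> along the coordinates outside \<open>\<tau>\<close>. This stays in the box of \<open>(u, \<tau>)\<close>, and for large
  \<open>m\<close> it makes up for the negative entries outside \<open>\<tau>\<close> of any fixed vector.\<close>

definition push :: "('n::finite \<Rightarrow>\<^sub>0 nat) \<Rightarrow> 'n set \<Rightarrow> nat \<Rightarrow> ('n \<Rightarrow>\<^sub>0 nat)" where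
  "push u \<tau> m = Abs_poly_mapping (\<lambda>i. Poly_Mapping.lookup u i + (if i \<in> \<tau> then 0 else m))"

lemma lookup_push [simp]:
  "Poly_Mapping.lookup (push u \<tau> m) i = Poly_Mapping.lookup u i + (if i \<in> \<tau> then 0 else m)"
  by (simp add: push_def)

text \<open>A cheaper direction could be taken integral; starting at \<open>push u \<tau> m\<close> with \<open>m\<close> large, one step in this
  direction stays nonnegative and lowers the cost.\<close>

lemma recession_nonneg_if_push_optimal:
  fixes A :: "int ^ 'n ^ 'd"
  assumes opt: "\<And>m. ip_optimal A c (push u \<tau> m)"
  shows "recession_nonneg A c \<tau>"
proof (rule ccontr)
  assume "\<not> ?thesis"
  then obtain w where "real_mat A *v w = 0" "\<And>i. i \<in> \<tau> \<Longrightarrow> 0 \<le> w $ i" "c \<bullet> w < 0"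
    unfolding recession_nonneg_def by (auto simp: not_le)
  then obtain p :: "int ^ 'n"
    where p: "A *v p = 0" "\<And>i. i \<in> \<tau> \<Longrightarrow> 0 \<le> p $ i" "c \<bullet> real_vec p < 0"
    using integral_kernel_direction by blast
  define m where "m = nat (\<Sum>i\<in>UNIV. \<bar>p $ i\<bar>)"
  have m: "- (p $ i) \<le> int m" for i
  proof -
    have "\<bar>p $ i\<bar> \<le> (\<Sum>i\<in>UNIV. \<bar>p $ i\<bar>)" by (rule member_le_sum) simp_all
    then show ?thesis by (simp add: m_def)
  qed
  let ?z = "int_vec (push u \<tau> m)"
  have "?z + p \<in> ip_feasible A (A *v ?z)"
  proof -
    have "0 \<le> (?z + p) $ i" for i
      using p(2)[of i] m[of i] by simp
    then show ?thesis by (simp add: ip_feasible_def matrix_vector_right_distrib p(1))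
  qed
  then have "c \<bullet> real_vec ?z \<le> c \<bullet> real_vec (?z + p)"
    using opt[of m] by (simp add: ip_optimal_def)
  then show False using p(3) by (simp add: real_vec_add inner_add_right)
qed

text \<open>The right-hand side refers to the optimal exponents alone. Therefore the left-hand side
  takes the same value for any two costs that define the same monomial ideal.\<close>

lemma recession_nonneg_iff_optimal:
  "recession_nonneg A c \<tau> \<longleftrightarrow> (\<forall>z. Poly_Mapping.keys z \<inter> \<tau> = {} \<longrightarrow> ip_optimal A c z)"
proof
  assume rec: "recession_nonneg A c \<tau>"
  show "\<forall>z. Poly_Mapping.keys z \<inter> \<tau> = {} \<longrightarrow> ip_optimal A c z"
  proof (intro allI impI)
    fix z :: "'a \<Rightarrow>\<^sub>0 nat" assume z: "Poly_Mapping.keys z \<inter> \<tau> = {}"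
    show "ip_optimal A c z"
      unfolding ip_optimal_def
    proof
      fix v assume v: "v \<in> ip_feasible A (A *v int_vec z)"
      let ?w = "real_vec (v - int_vec z)"
      have "real_mat A *v ?w = 0"
        using v by (simp add: real_mat_real_vec matrix_vector_mult_diff_distrib ip_feasible_def)
      moreover have "0 \<le> ?w $ i" if "i \<in> \<tau>" for i
      proof -
        have "Poly_Mapping.lookup z i = 0" using z that by (auto simp: in_keys_iff)
        then show ?thesis using v by (simp add: ip_feasible_def)
      qed
      ultimately have "0 \<le> c \<bullet> ?w"
        using rec unfolding recession_nonneg_def by blast
      then show "c \<bullet> real_vec (int_vec z) \<le> c \<bullet> real_vec v"
        by (simp add: real_vec_diff inner_diff_right)
    qed
  qed
next
  assume opt: "\<forall>z. Poly_Mapping.keys z \<inter> \<tau> = {} \<longrightarrow> ip_optimal A c z"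
  have "Poly_Mapping.keys (push 0 \<tau> m) \<inter> \<tau> = {}" for m
    by (auto simp: in_keys_iff split: if_splits)
  then show "recession_nonneg A c \<tau>"
    using opt by (intro recession_nonneg_if_push_optimal[of A c 0]) blast
qed

text \<open>At a feasible \<open>v\<close> only the sign constraints with \<open>v\<^sub>i = 0\<close> are active, and \<open>v\<close> is optimal exactly if no
  direction that respects these lowers the cost. In this form optimality is again a statement about a
  recession cone.\<close>

lemma relaxed_optimal_iff:
  "relaxed_optimal A c u \<tau> v \<longleftrightarrow>
     v \<in> relaxed_feasible A u \<tau> \<and> recession_nonneg A c {i \<in> \<tau>. v $ i = 0}"
proof
  assume opt: "relaxed_optimal A c u \<tau> v"
  then have v: "v \<in> relaxed_feasible A u \<tau>" by (simp add: relaxed_optimal_def)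
  have "0 \<le> c \<bullet> w" if w: "real_mat A *v w = 0" "\<forall>i\<in>{i \<in> \<tau>. v $ i = 0}. 0 \<le> w $ i" for w
  proof -
    \<comment> \<open>A short step from \<open>v\<close> in the direction \<open>w\<close> remains feasible.\<close>
    have "\<forall>i\<in>\<tau>. eventually (\<lambda>e. 0 \<le> v $ i + e * w $ i) (at_right 0)"
    proof
      fix i assume i: "i \<in> \<tau>"
      show "eventually (\<lambda>e. 0 \<le> v $ i + e * w $ i) (at_right 0)"
      proof (cases "v $ i = 0")
        case True
        then have "0 \<le> w $ i" using w(2) i by simp
        then show ?thesis
          using True eventually_at_right_less[of "0 :: real"]
          by (auto elim!: eventually_mono)
      next
        case False
        then have "0 < v $ i" using v i by (simp add: relaxed_feasible_def less_le)
        have "((\<lambda>e. v $ i + e * w $ i) \<longlongrightarrow> v $ i + 0 * w $ i) (at_right 0)"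
          by (intro tendsto_intros)
        then have "eventually (\<lambda>e. 0 < v $ i + e * w $ i) (at_right 0)"
          using \<open>0 < v $ i\<close> by (intro order_tendstoD(1)[of _ "v $ i"]) simp_all
        then show ?thesis by (rule eventually_mono) simp
      qed
    qed
    then have "eventually (\<lambda>e. \<forall>i\<in>\<tau>. 0 \<le> v $ i + e * w $ i) (at_right 0)"
      by (intro eventually_ball_finite) simp_all
    then have "eventually (\<lambda>e. (\<forall>i\<in>\<tau>. 0 \<le> v $ i + e * w $ i) \<and> 0 < e) (at_right (0 :: real))"
      by (intro eventually_conj eventually_at_right_less)
    then obtain e :: real where e: "\<forall>i\<in>\<tau>. 0 \<le> v $ i + e * w $ i" "0 < e"
      using eventually_happens[of _ "at_right (0 :: real)"] by auto
    have "v + e *\<^sub>R w \<in> relaxed_feasible A u \<tau>"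
      using v w(1) e(1)
      by (simp add: relaxed_feasible_def matrix_vector_right_distrib matrix_vector_mult_scaleR)
    then have "c \<bullet> v \<le> c \<bullet> (v + e *\<^sub>R w)"
      using opt unfolding relaxed_optimal_def by fastforce
    then show ?thesis using e(2) by (simp add: inner_add_right zero_le_mult_iff)
  qed
  then show "v \<in> relaxed_feasible A u \<tau> \<and> recession_nonneg A c {i \<in> \<tau>. v $ i = 0}"
    using v by (simp add: recession_nonneg_def)
next
  assume v: "v \<in> relaxed_feasible A u \<tau> \<and> recession_nonneg A c {i \<in> \<tau>. v $ i = 0}"
  have "c \<bullet> v \<le> c \<bullet> v'" if v': "v' \<in> relaxed_feasible A u \<tau>" for v'
  proof -
    have "real_mat A *v (v' - v) = 0" "\<forall>i\<in>{i \<in> \<tau>. v $ i = 0}. 0 \<le> (v' - v) $ i"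
      using v v' by (simp_all add: relaxed_feasible_def matrix_vector_mult_diff_distrib)
    then have "0 \<le> c \<bullet> (v' - v)" using v unfolding recession_nonneg_def by blast
    then show ?thesis by (simp add: inner_diff_right)
  qed
  then show "relaxed_optimal A c u \<tau> v"
    using v by (simp add: relaxed_optimal_def)
qed

text \<open>The sign cone is finitely generated, hence so is its image, and finitely generated cones are closed.\<close>

lemma closed_linear_image_sign_cone:
  fixes T :: "real ^ 'n \<Rightarrow> 'b::euclidean_space"
  assumes "linear T"
  shows "closed (T ` {x. \<forall>i\<in>\<tau>. 0 \<le> x $ i})"
proof -
  define N where "N = {x :: real ^ 'n. \<forall>i\<in>\<tau>. 0 \<le> x $ i}"
  define S where "S = range (\<lambda>i :: 'n. axis i (1 :: real)) \<union> (\<lambda>i. - axis i 1) ` (- \<tau>)"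
  have "finite S" by (simp add: S_def)
  have "convex_cone hull S = N"
  proof
    have "convex_cone N" by (simp add: convex_cone_iff N_def)
    moreover have "S \<subseteq> N" by (auto simp: S_def N_def axis_def)
    ultimately show "convex_cone hull S \<subseteq> N" by (rule hull_minimal[rotated])
    have sum_mem: "(\<Sum>i\<in>I. f i) \<in> convex_cone hull S"
      if "finite I" "\<And>i. i \<in> I \<Longrightarrow> f i \<in> convex_cone hull S" for I :: "'n set" and f
      using that by (induction I) (simp_all add: convex_cone_hull_contains_0 convex_cone_hull_add)
    show "N \<subseteq> convex_cone hull S"
    proof
      fix x assume x: "x \<in> N"
      have "(\<Sum>i\<in>UNIV. x $ i *\<^sub>R axis i 1) \<in> convex_cone hull S"
      proof (rule sum_mem)
        fix i :: 'n
        show "x $ i *\<^sub>R axis i 1 \<in> convex_cone hull S"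
        proof (cases "0 \<le> x $ i")
          case True
          then show ?thesis
            by (intro convex_cone_hull_mul hull_inc) (auto simp: S_def)
        next
          case False
          then have "i \<notin> \<tau>" using x by (auto simp: N_def)
          then have "(- (x $ i)) *\<^sub>R (- axis i 1) \<in> convex_cone hull S"
            using False by (intro convex_cone_hull_mul hull_inc) (auto simp: S_def)
          then show ?thesis by simp
        qed
      qed simp
      then show "x \<in> convex_cone hull S"
        by (simp only: basis_expansion scalar_mult_eq_scaleR[symmetric])
    qed
  qed
  then have "T ` N = convex_cone hull (T ` S)"
    using convex_cone_hull_linear_image[OF assms, of S] by simp
  then show ?thesis
    using closed_convex_cone_hull[of "T ` S"] \<open>finite S\<close> by (simp add: N_def)
qed

text \<open>The pairs of right-hand side and objective value form a closed cone \<open>C\<close>. Its slice over \<open>b\<close> is the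
  set of attainable objective values, which is therefore closed. The slice is bounded below: attainable
  values tending to \<open>-\<infinity>\<close>, rescaled, would bring \<open>(0, -1)\<close> into \<open>C\<close>, that is, give a
  recession direction of negative cost.\<close>

lemma lp_attains_minimum:
  fixes A :: "int ^ 'n ^ 'd"
  assumes rec: "recession_nonneg A c \<tau>"
    and x0: "real_mat A *v x0 = b" "\<forall>i\<in>\<tau>. 0 \<le> x0 $ i"
  shows "\<exists>v. (real_mat A *v v = b \<and> (\<forall>i\<in>\<tau>. 0 \<le> v $ i)) \<and>
    (\<forall>x. real_mat A *v x = b \<and> (\<forall>i\<in>\<tau>. 0 \<le> x $ i) \<longrightarrow> c \<bullet> v \<le> c \<bullet> x)"
proof -
  define T where "T x = (real_mat A *v x, c \<bullet> x)" for x
  define C where "C = T ` {x. \<forall>i\<in>\<tau>. 0 \<le> x $ i}"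
  define X where "X = {s. (b, s) \<in> C}"
  have "linear T"
    unfolding T_def
    by (rule linearI) (simp_all add: matrix_vector_right_distrib matrix_vector_mult_scaleR inner_add_right)
  then have "closed C" unfolding C_def by (rule closed_linear_image_sign_cone)
  have X: "s \<in> X \<longleftrightarrow> (\<exists>x. real_mat A *v x = b \<and> (\<forall>i\<in>\<tau>. 0 \<le> x $ i) \<and> s = c \<bullet> x)" for s
    by (auto simp: X_def C_def T_def)
  have "closed ((\<lambda>s. (b, s)) -` C)"
    by (intro closed_vimage \<open>closed C\<close> continuous_intros)
  then have "closed X" by (simp add: X_def vimage_def)
  moreover have "X \<noteq> {}" using x0 X by blast
  moreover have "bdd_below X"
  proof -
    have "(0, -1) \<notin> C"
    proof
      assume "(0, -1) \<in> C"
      then obtain w where "real_mat A *v w = 0" "\<forall>i\<in>\<tau>. 0 \<le> w $ i" "c \<bullet> w = -1"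
        by (auto simp: C_def T_def)
      then show False using rec unfolding recession_nonneg_def by (metis neg_0_le_iff_le not_one_le_zero)
    qed
    then obtain r where r: "0 < r" "ball (0, -1) r \<subseteq> - C"
      using \<open>closed C\<close> open_contains_ball[of "- C"] by auto
    have "- (norm b / r + 1) \<le> s" if "s \<in> X" for s
    proof (rule ccontr)
      assume "\<not> ?thesis"
      then have s: "norm b / r + 1 < - s" by simp
      have "0 \<le> norm b / r" using r(1) by simp
      then have "0 < - s" using s by linarith
      obtain x where x: "real_mat A *v x = b" "\<forall>i\<in>\<tau>. 0 \<le> x $ i" "s = c \<bullet> x"
        using \<open>s \<in> X\<close> X by blast
      \<comment> \<open>Rescaling to objective value \<open>-1\<close> brings the right-hand side within distance \<open>r\<close> of \<open>0\<close>.\<close>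
      define k where "k = 1 / (- s)"
      have "0 < k" "k * s = - 1" using \<open>0 < - s\<close> by (simp_all add: k_def)
      have "T (k *\<^sub>R x) \<in> C"
        using x(2) \<open>0 < k\<close> by (auto simp: C_def)
      moreover have "T (k *\<^sub>R x) = (k *\<^sub>R b, -1)"
        using x \<open>k * s = - 1\<close> by (simp add: T_def matrix_vector_mult_scaleR)
      moreover have "(k *\<^sub>R b, -1) \<in> ball (0, -1) r"
      proof -
        have "norm b < r * (- s)"
          using s r(1) by (simp add: field_simps)
        then have "norm b / (- s) < r" by (simp only: pos_divide_less_eq[OF \<open>0 < - s\<close>])
        then show ?thesis using \<open>0 < k\<close> \<open>0 < - s\<close> by (simp add: dist_Pair_Pair dist_norm k_def)
      qed
      ultimately show False using r(2) by auto
    qed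
    then show ?thesis by (rule bdd_belowI)
  qed
  ultimately have "Inf X \<in> X" by (intro closed_contains_Inf)
  moreover have "Inf X \<le> c \<bullet> x" if "real_mat A *v x = b" "\<forall>i\<in>\<tau>. 0 \<le> x $ i" for x
    using that X \<open>bdd_below X\<close> by (intro cInf_lower) auto
  ultimately show ?thesis using X by metis
qed

text \<open>For real costs the objective values need not form a discrete set. But a feasible point above
  another one differs from it by a nonnegative kernel vector and so is not cheaper, and by Dickson's
  lemma finitely many points suffice to lie below all others.\<close>

lemma ip_attains_minimum:
  fixes A :: "int ^ 'n ^ 'd"
  assumes rec: "recession_nonneg A c UNIV" and feas: "ip_feasible A b \<noteq> {}"
  obtains u where "int_vec u \<in> ip_feasible A b" "ip_optimal A c u"
proof -
  let ?F = "ip_feasible A b"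
  obtain B where B: "finite B" "B \<subseteq> ?F" "\<forall>s\<in>?F. \<exists>b\<in>B. \<forall>i\<in>UNIV. nat (b $ i) \<le> nat (s $ i)"
    using Dickson[of UNIV ?F "\<lambda>u i. nat (u $ i)"] by auto
  have "B \<noteq> {}" using B(3) feas by blast
  define z where "z = arg_min_on (\<lambda>u. c \<bullet> real_vec u) B"
  have z: "z \<in> B" "\<And>y. y \<in> B \<Longrightarrow> c \<bullet> real_vec z \<le> c \<bullet> real_vec y"
    unfolding z_def using arg_min_if_finite[OF B(1) \<open>B \<noteq> {}\<close>] arg_min_least[OF B(1) \<open>B \<noteq> {}\<close>] by auto
  have min: "c \<bullet> real_vec z \<le> c \<bullet> real_vec s" if s: "s \<in> ?F" for s
  proof -
    obtain y where y: "y \<in> B" "\<forall>i. nat (y $ i) \<le> nat (s $ i)" using B(3) s by blast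
    have "y \<in> ?F" using y(1) B(2) by blast
    have "real_mat A *v real_vec (s - y) = 0"
      using s \<open>y \<in> ?F\<close> by (simp add: real_mat_real_vec matrix_vector_mult_diff_distrib ip_feasible_def)
    moreover have "0 \<le> real_vec (s - y) $ i" for i
      using y(2) s by (simp add: ip_feasible_def nat_le_eq_zle)
    ultimately have "0 \<le> c \<bullet> real_vec (s - y)"
      using rec unfolding recession_nonneg_def by blast
    then show ?thesis using z(2)[OF y(1)] by (simp add: real_vec_diff inner_diff_right)
  qed
  define u where "u = Abs_poly_mapping (\<lambda>i. nat (z $ i))"
  have "z \<in> ?F" using z(1) B(2) by blast
  then have "int_vec u = z"
    by (simp add: u_def vec_eq_iff ip_feasible_def)
  moreover have "A *v z = b" using \<open>z \<in> ?F\<close> by (simp add: ip_feasible_def)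
  ultimately show thesis
    using that[of u] min \<open>z \<in> ?F\<close> by (simp add: ip_optimal_def)
qed

lemma ip_optimal_mono:
  assumes opt: "ip_optimal A c w" and le: "\<And>i. Poly_Mapping.lookup s i \<le> Poly_Mapping.lookup w i"
  shows "ip_optimal A c s"
  unfolding ip_optimal_def
proof
  fix v assume v: "v \<in> ip_feasible A (A *v int_vec s)"
  let ?d = "int_vec w - int_vec s"
  have "v + ?d \<in> ip_feasible A (A *v int_vec w)"
    using v le by (simp add: ip_feasible_def matrix_vector_right_distrib matrix_vector_mult_diff_distrib)
  then have "c \<bullet> real_vec (int_vec w) \<le> c \<bullet> real_vec (v + ?d)"
    using opt by (simp add: ip_optimal_def)
  then show "c \<bullet> real_vec (int_vec s) \<le> c \<bullet> real_vec v"
    by (simp add: real_vec_add real_vec_diff inner_add_right inner_diff_right)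
qed

lemma monomial_mem_nonopt_ideal:
  "monomial w \<in> nonopt_ideal A c \<longleftrightarrow> \<not> ip_optimal A c w"
  unfolding nonopt_ideal_def monomial_mem_generated_ideal
  using ip_optimal_mono by blast

text \<open>Both sides say that \<open>0\<close> is not optimal: the ideal is the whole ring exactly if it contains \<open>1 = x\<^sup>0\<close>.\<close>

lemma nonopt_ideal_eq_UNIV_iff:
  "nonopt_ideal A c = UNIV \<longleftrightarrow> \<not> recession_nonneg A c UNIV"
proof -
  have "recession_nonneg A c UNIV \<longleftrightarrow> ip_optimal A c 0"
    unfolding recession_nonneg_iff_optimal by auto
  moreover have "nonopt_ideal A c = UNIV \<longleftrightarrow> monomial 0 \<in> nonopt_ideal A c"
  proof
    assume "monomial 0 \<in> nonopt_ideal A c"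
    then have "monomial w \<in> nonopt_ideal A c" for w
      using ip_optimal_mono[of A c w 0] by (auto simp: monomial_mem_nonopt_ideal)
    moreover have "monomial_ideal (nonopt_ideal A c)"
      unfolding nonopt_ideal_def by (rule monomial_ideal_generated)
    ultimately show "nonopt_ideal A c = UNIV"
      by (auto simp: monomial_ideal_def)
  qed simp
  ultimately show ?thesis by (simp add: monomial_mem_nonopt_ideal)
qed

lemma ip_value_attained:
  assumes "int_vec u \<in> ip_feasible A b" "ip_optimal A c u"
  shows "ip_value A c b = c \<bullet> real_vec (int_vec u)" "ip_feasible_bounded A c b"
proof -
  have "A *v int_vec u = b" using assms(1) by (simp add: ip_feasible_def)
  then have least: "c \<bullet> real_vec (int_vec u) \<le> c \<bullet> real_vec v" if "v \<in> ip_feasible A b" for v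
    using assms(2) that by (simp add: ip_optimal_def)
  then show "ip_value A c b = c \<bullet> real_vec (int_vec u)"
    unfolding ip_value_def using assms(1) by (intro cInf_eq_minimum) auto
  show "ip_feasible_bounded A c b"
    unfolding ip_feasible_bounded_def using assms(1) least by (auto intro!: bdd_belowI2)
qed

text \<open>By the two characterisations above, whether \<open>v\<close> is optimal depends only on the set of optimal exponents.
  So all costs in the interior of a Groebner cone have the same optimal solutions.\<close>

lemma relaxed_optimal_transfer:
  assumes same: "\<And>z. ip_optimal A c z \<Longrightarrow> ip_optimal A c' z" and opt: "relaxed_optimal A c u \<tau> v"
  shows "relaxed_optimal A c' u \<tau> v"
  using opt same unfolding relaxed_optimal_iff recession_nonneg_iff_optimal by blast

text \<open>Two common optimal solutions have the same cost for an open set of cost vectors, so their difference is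
  orthogonal to this set.\<close>

lemma relaxed_optimal_unique:
  assumes "open U" "U \<noteq> {}"
    and v: "\<And>c. c \<in> U \<Longrightarrow> relaxed_optimal A c u \<tau> v"
    and v': "\<And>c. c \<in> U \<Longrightarrow> relaxed_optimal A c u \<tau> v'"
  shows "v = v'"
proof -
  have eq: "c \<bullet> (v - v') = 0" if "c \<in> U" for c
    using v[OF that] v'[OF that] by (force simp: relaxed_optimal_def inner_diff_right)
  obtain c where c: "c \<in> U" using assms(2) by blast
  then obtain e where e: "0 < e" "ball c e \<subseteq> U"
    using assms(1) open_contains_ball by blast
  \<comment> \<open>A step length that keeps \<open>c + t (v - v')\<close> within distance \<open>e\<close> of \<open>c\<close>.\<close>
  define t where "t = e / 2 / (norm (v - v') + 1)"
  have "0 < t" using e(1) by (simp add: t_def add_nonneg_pos)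
  have "t * norm (v - v') < e"
  proof -
    have "t * norm (v - v') \<le> t * (norm (v - v') + 1)" using \<open>0 < t\<close> by simp
    also have "\<dots> = e / 2"
      unfolding t_def
    proof (rule nonzero_divide_eq_eq[THEN iffD1, OF _ refl, symmetric])
      show "norm (v - v') + 1 \<noteq> 0" using norm_ge_zero[of "v - v'"] by linarith
    qed
    finally show ?thesis using e(1) by simp
  qed
  then have "c + t *\<^sub>R (v - v') \<in> U"
    using e(2) \<open>0 < t\<close> by (auto simp: dist_norm)
  then have "(c + t *\<^sub>R (v - v')) \<bullet> (v - v') = 0" by (rule eq)
  then have "t * ((v - v') \<bullet> (v - v')) = 0"
    using eq[OF c] by (simp add: inner_add_left)
  then show ?thesis using \<open>0 < t\<close> by simp
qed

section \<open>Maximal cones\<close>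

text \<open>The cells with empty interior are negligible, so the full-dimensional ones are dense in the union; being
  closed and finite in number, they cover it. A relative interior point of \<open>K\<close> thus lies in a
  full-dimensional cell \<open>C\<close>, and then the face \<open>K \<inter> C\<close> of \<open>K\<close> must be all of \<open>K\<close>.\<close>

lemma maximal_cell_full_dimensional:
  fixes K :: "'a::euclidean_space set"
  assumes \<C>: "polyhedral_complex \<C>" and S: "convex (\<Union>\<C>)" "interior (\<Union>\<C>) \<noteq> {}"
    and K: "K \<in> \<C>" "\<And>C. C \<in> \<C> \<Longrightarrow> K \<subseteq> C \<Longrightarrow> C = K"
  shows "interior K \<noteq> {}"
proof -
  define \<D> where "\<D> = {C\<in>\<C>. interior C \<noteq> {}}"
  have fin: "finite \<C>" and poly: "\<And>C. C \<in> \<C> \<Longrightarrow> polyhedron C \<and> C \<noteq> {}"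
    using \<C> by (auto simp: polyhedral_complex_def)
  have "finite \<D>" using fin by (simp add: \<D>_def)
  then have closed_D: "closed (\<Union>\<D>)"
    by (intro closed_Union ballI) (simp_all add: \<D>_def poly polyhedron_imp_closed)
  have "negligible (\<Union>(\<C> - \<D>))"
  proof (rule negligible_Union)
    show "finite (\<C> - \<D>)" using fin by simp
    fix C assume C: "C \<in> \<C> - \<D>"
    then have "convex C" using poly polyhedron_imp_convex by blast
    then show "negligible C" using C by (simp add: negligible_convex_interior \<D>_def)
  qed
  moreover have "interior (\<Union>\<C>) - \<Union>\<D> \<subseteq> \<Union>(\<C> - \<D>)"
    using interior_subset[of "\<Union>\<C>"] by blast
  ultimately have "negligible (interior (\<Union>\<C>) - \<Union>\<D>)"
    by (rule negligible_subset)
  moreover have "open (interior (\<Union>\<C>) - \<Union>\<D>)"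
    using closed_D by (simp add: open_Diff)
  ultimately have "interior (\<Union>\<C>) \<subseteq> \<Union>\<D>"
    using open_not_negligible[of "interior (\<Union>\<C>) - \<Union>\<D>"] by blast
  then have "closure (interior (\<Union>\<C>)) \<subseteq> \<Union>\<D>"
    using closed_D by (simp add: closure_minimal)
  then have cover: "\<Union>\<C> \<subseteq> \<Union>\<D>"
    unfolding convex_closure_interior[OF S] by (rule order_trans[OF closure_subset])
  have "convex K" using poly[OF K(1)] polyhedron_imp_convex by blast
  then obtain x where x: "x \<in> rel_interior K"
    using poly[OF K(1)] rel_interior_eq_empty[of K] by blast
  then have "x \<in> K" using rel_interior_subset by blast
  then obtain C where C: "C \<in> \<D>" "x \<in> C" using cover K(1) by blast
  then have "C \<in> \<C>" by (simp add: \<D>_def)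
  then have "K \<inter> C face_of K"
    using \<C> K(1) unfolding polyhedral_complex_def by blast
  then have "K \<subseteq> K \<inter> C"
    using subset_of_face_of[of "K \<inter> C" K K] x \<open>x \<in> K\<close> C(2) by blast
  then have "C = K" using K(2)[OF \<open>C \<in> \<C>\<close>] by blast
  then show ?thesis using C(1) by (simp add: \<D>_def)
qed

lemma convex_bounded_costs: "convex {c. recession_nonneg A c UNIV}"
proof (rule convexI)
  fix c c' u v assume "c \<in> {c. recession_nonneg A c UNIV}" "c' \<in> {c. recession_nonneg A c UNIV}"
    and "0 \<le> (u::real)" "0 \<le> v" "u + v = 1"
  then show "u *\<^sub>R c + v *\<^sub>R c' \<in> {c. recession_nonneg A c UNIV}"
    by (simp add: recession_nonneg_def inner_add_left)
qed

text \<open>Positive costs are bounded below on nonnegative vectors.\<close>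

lemma interior_bounded_costs: "interior {c. recession_nonneg A c UNIV} \<noteq> {}"
proof -
  let ?B = "box 0 (\<Sum>Basis) :: (real ^ 'a) set"
  have "c \<in> {c. recession_nonneg A c UNIV}" if "c \<in> ?B" for c
  proof -
    have "0 \<le> c $ i" for i
      using that by (simp add: mem_box_cart less_imp_le)
    then show ?thesis
      by (auto simp: recession_nonneg_def inner_vec_def intro!: sum_nonneg)
  qed
  then have "?B \<subseteq> interior {c. recession_nonneg A c UNIV}"
    by (intro interior_maximal) auto
  moreover have "?B \<noteq> {}"
    by (simp add: box_ne_empty)
  ultimately show ?thesis by blast
qed

text \<open>For carrying inequalities from interior costs to costs on the boundary of a cone.\<close>

lemma le_on_full_dimensional_convex:
  fixes K :: "(real ^ 'n) set"
  assumes "convex K" "interior K \<noteq> {}" "\<And>c. c \<in> interior K \<Longrightarrow> c \<bullet> x \<le> c \<bullet> y" "c \<in> K"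
  shows "c \<bullet> x \<le> c \<bullet> y"
proof -
  have "closure (interior K) \<subseteq> {c. c \<bullet> x \<le> c \<bullet> y}"
    using assms(3) by (intro closure_minimal closed_Collect_le continuous_intros) auto
  moreover have "c \<in> closure (interior K)"
    using assms(4) closure_subset unfolding convex_closure_interior[OF assms(1,2)] by blast
  ultimately show ?thesis by blast
qed

section \<open>Lower envelopes of maxima of linear functions\<close>

lemma polyhedron_linear_vimage:
  fixes h :: "'a::euclidean_space \<Rightarrow> 'b::euclidean_space"
  assumes "linear h" "polyhedron S"
  shows "polyhedron (h -` S)"
proof -
  obtain H where H: "finite H" "S = \<Inter>H" "\<And>X. X \<in> H \<Longrightarrow> \<exists>a b. a \<noteq> 0 \<and> X = {x. a \<bullet> x \<le> b}"
    using assms(2) unfolding polyhedron_def by blast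
  have "polyhedron (h -` X)" if X: "X \<in> H" for X
  proof -
    obtain a b where "X = {x. a \<bullet> x \<le> b}" using H(3)[OF X] by blast
    then have "h -` X = {x. adjoint h a \<bullet> x \<le> b}"
      by (auto simp: adjoint_clauses[OF assms(1)])
    then show ?thesis by (simp add: polyhedron_halfspace_le)
  qed
  then have "polyhedron (\<Inter>X\<in>H. h -` X)"
    using H(1) by (intro polyhedron_Inter) auto
  then show ?thesis
    by (simp add: H(2) vimage_INT[of h "\<lambda>X. X" H, simplified])
qed

text \<open>A face \<open>F\<close> of the lower envelope lies in the graph of the maximum \<open>f\<close>. At a relative interior
  point of \<open>F\<close> some \<open>c \<bullet> a\<close> attains the maximum; the nonnegative linear function
  \<open>t - c \<bullet> a\<close> on \<open>F\<close> vanishes there, hence on all of \<open>F\<close>. So \<open>F\<close> is the image of its projection under the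
  injective linear map \<open>h a\<close>, which preserves and reflects faces. Conversely, the points of
  the epigraph with \<open>t = c \<bullet> a\<close> form a face of the lower envelope, and these faces cover the graph.\<close>

lemma projected_envelope_max:
  fixes K :: "'a::euclidean_space set" and J :: "'a set"
  assumes K: "polyhedron K" and J: "finite J" "J \<noteq> {}"
  defines "G \<equiv> {(c, t). c \<in> K \<and> (\<forall>a\<in>J. c \<bullet> a \<le> t)}"
  shows polyhedral_subdivision_projected_envelope: "polyhedral_subdivision (projected_envelope G) K"
    and max_linear_on_projected_envelope:
      "D \<in> projected_envelope G \<Longrightarrow> \<exists>a\<in>J. \<forall>c\<in>D. Max ((\<bullet>) c ` J) = c \<bullet> a"
proof -
  define f where "f c = Max ((\<bullet>) c ` J)" for c
  define h where "h a c = (c, c \<bullet> a)" for a c :: 'a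
  have f_ge: "c \<bullet> a \<le> f c" if "a \<in> J" for a c
    using that J by (simp add: f_def)
  have f_attained: "\<exists>a\<in>J. f c = c \<bullet> a" for c
  proof -
    have "f c \<in> (\<bullet>) c ` J" unfolding f_def by (rule Max_in) (use J in auto)
    then show ?thesis by blast
  qed
  have mem_G: "(c, t) \<in> G \<longleftrightarrow> c \<in> K \<and> f c \<le> t" for c t
    using J by (simp add: G_def f_def)
  have lin_h: "linear (h a)" for a
    unfolding h_def by (rule linearI) (simp_all add: inner_add_left)
  have inj_h: "inj (h a)" for a
    unfolding h_def by (rule injI) simp
  have "G = fst -` K \<inter> (\<Inter>a\<in>J. {x. (a, -1) \<bullet> x \<le> 0})"
    by (auto simp: G_def inner_commute)
  moreover have "polyhedron (fst -` K :: ('a \<times> real) set)"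
    by (rule polyhedron_linear_vimage[OF linear_fst K])
  moreover have "polyhedron (\<Inter>a\<in>J. {x. (a, -1 :: real) \<bullet> x \<le> 0})"
    using J(1) by (intro polyhedron_Inter) (auto simp: polyhedron_halfspace_le)
  ultimately have poly_G: "polyhedron G"
    by simp
  have env_height: "t = f c" if "F \<in> lower_envelope G" "(c, t) \<in> F" for F c t
  proof -
    have "(c, t) \<in> G" using that face_of_imp_subset by (auto simp: lower_envelope_def)
    then have "c \<in> K" "f c \<le> t" by (simp_all add: mem_G)
    moreover have "t \<le> f c"
      using that \<open>c \<in> K\<close> mem_G[of c "f c"] unfolding lower_envelope_def by blast
    ultimately show ?thesis by simp
  qed
  have env_graph: "\<exists>a\<in>J. F = h a ` fst ` F" if F: "F \<in> lower_envelope G" for F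
  proof -
    have "F face_of G" "F \<noteq> {}" using F by (auto simp: lower_envelope_def)
    then have "convex F" by (simp add: face_of_imp_convex)
    then obtain x0 where x0: "x0 \<in> rel_interior F"
      using \<open>F \<noteq> {}\<close> rel_interior_eq_empty by blast
    obtain a where a: "a \<in> J" "f (fst x0) = fst x0 \<bullet> a" using f_attained by blast
    have height: "snd x = f (fst x)" if "x \<in> F" for x
      by (rule env_height[OF F]) (simp add: that)
    let ?T = "F \<inter> {x. (- a, 1) \<bullet> x = 0}"
    have "?T face_of F"
    proof (rule face_of_Int_supporting_hyperplane_ge[OF \<open>convex F\<close>])
      fix x assume "x \<in> F"
      then show "0 \<le> (- a, 1) \<bullet> x"
        using height[of x] f_ge[OF a(1), of "fst x"] by (cases x) (simp add: inner_commute)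
    qed
    moreover have "x0 \<in> ?T"
    proof -
      have "x0 \<in> F" using x0 rel_interior_subset by blast
      then show ?thesis using height[of x0] a(2) by (cases x0) (simp add: inner_commute)
    qed
    ultimately have "F \<subseteq> ?T"
      using subset_of_face_of[of ?T F F] x0 by blast
    then have "h a (fst x) = x" if "x \<in> F" for x
      using that by (cases x) (auto simp: h_def inner_commute)
    then have "h a ` fst ` F = F"
      by (simp add: image_image)
    then have "F = h a ` fst ` F" ..
    then show ?thesis using a(1) by blast
  qed
  have fst_env: "fst ` F = {c. (c, f c) \<in> F}" if "F \<in> lower_envelope G" for F
  proof
    show "fst ` F \<subseteq> {c. (c, f c) \<in> F}"
    proof
      fix c assume "c \<in> fst ` F"
      then obtain t where t: "(c, t) \<in> F" by auto
      then show "c \<in> {c. (c, f c) \<in> F}" using env_height[OF that t] by simp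
    qed
    show "{c. (c, f c) \<in> F} \<subseteq> fst ` F" by force
  qed
  show linear_pieces: "\<exists>a\<in>J. \<forall>c\<in>D. Max ((\<bullet>) c ` J) = c \<bullet> a" if D: "D \<in> projected_envelope G" for D
  proof -
    obtain F where F: "F \<in> lower_envelope G" "D = fst ` F"
      using D by (auto simp: projected_envelope_def)
    obtain a where a: "a \<in> J" "F = h a ` D" using env_graph F by blast
    have "f c = c \<bullet> a" if "c \<in> D" for c
    proof -
      have "(c, c \<bullet> a) \<in> F" using that a(2) by (auto simp: h_def)
      then show ?thesis by (rule env_height[OF F(1), symmetric])
    qed
    then show ?thesis using a(1) by (auto simp: f_def)
  qed
  have "polyhedral_complex (projected_envelope G)"
    unfolding polyhedral_complex_def
  proof (intro conjI ballI allI impI)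
    have "lower_envelope G \<subseteq> {F. F face_of G}" by (auto simp: lower_envelope_def)
    then show "finite (projected_envelope G)"
      unfolding projected_envelope_def
      using finite_polyhedron_faces[OF poly_G] finite_subset by blast
  next
    fix D assume "D \<in> projected_envelope G"
    then obtain F where F: "F \<in> lower_envelope G" "D = fst ` F"
      by (auto simp: projected_envelope_def)
    then obtain a where a: "F = h a ` D" using env_graph by blast
    have "D = h a -` F" using inj_h[of a] by (simp add: a inj_vimage_image_eq)
    moreover have "polyhedron F"
      using F(1) poly_G face_of_polyhedron_polyhedron by (auto simp: lower_envelope_def)
    ultimately show "polyhedron D"
      using polyhedron_linear_vimage[OF lin_h] by simp
    show "D \<noteq> {}" using F by (auto simp: lower_envelope_def)
  next
    fix D E assume "D \<in> projected_envelope G" and E: "E face_of D \<and> E \<noteq> {}"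
    then obtain F where F: "F \<in> lower_envelope G" "D = fst ` F"
      by (auto simp: projected_envelope_def)
    then obtain a where a: "F = h a ` D" using env_graph by blast
    have "h a ` E face_of F"
      using E by (simp add: a face_of_linear_image[OF lin_h inj_h])
    moreover have "F face_of G" using F(1) by (simp add: lower_envelope_def)
    ultimately have "h a ` E face_of G" "h a ` E \<subseteq> F"
      by (blast intro: face_of_trans, simp add: face_of_imp_subset)
    then have "h a ` E \<in> lower_envelope G"
      using F(1) E unfolding lower_envelope_def by blast
    moreover have "E = fst ` h a ` E" by (simp add: h_def image_image)
    ultimately show "E \<in> projected_envelope G"
      by (auto simp: projected_envelope_def)
  next
    have meet: "D \<inter> E face_of D" if D: "D \<in> projected_envelope G" and E: "E \<in> projected_envelope G" for D E
    proof -
      obtain F where F: "F \<in> lower_envelope G" "D = fst ` F"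
        using D by (auto simp: projected_envelope_def)
      obtain F' where F': "F' \<in> lower_envelope G" "E = fst ` F'"
        using E by (auto simp: projected_envelope_def)
      obtain a where a: "F = h a ` D" using env_graph F by blast
      have "F face_of G" "F' face_of G" using F(1) F'(1) by (auto simp: lower_envelope_def)
      then have "F \<inter> F' face_of F"
        by (simp add: face_of_Int face_of_face)
      moreover have "F \<inter> F' = h a ` (D \<inter> E)"
      proof -
        have "f c = c \<bullet> a" if "c \<in> D" for c
        proof -
          have "(c, c \<bullet> a) \<in> F" using that by (auto simp: a h_def)
          then show ?thesis by (rule env_height[OF F(1), symmetric])
        qed
        then have "h a ` (D \<inter> E) = (\<lambda>c. (c, f c)) ` (D \<inter> E)"
          by (simp add: h_def)
        also have "\<dots> = F \<inter> F'"
        proof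
          show "(\<lambda>c. (c, f c)) ` (D \<inter> E) \<subseteq> F \<inter> F'"
            by (auto simp: F(2) F'(2) fst_env[OF F(1)] fst_env[OF F'(1)])
          show "F \<inter> F' \<subseteq> (\<lambda>c. (c, f c)) ` (D \<inter> E)"
          proof
            fix x assume x: "x \<in> F \<inter> F'"
            then have "snd x = f (fst x)" by (intro env_height[OF F(1)]) simp
            then have "x = (fst x, f (fst x))" by (simp add: prod_eq_iff)
            moreover have "fst x \<in> D \<inter> E" using x F(2) F'(2) by blast
            ultimately show "x \<in> (\<lambda>c. (c, f c)) ` (D \<inter> E)" by (rule image_eqI)
          qed
        qed
        finally show ?thesis ..
      qed
      ultimately have "h a ` (D \<inter> E) face_of h a ` D" by (simp add: a[symmetric])
      then show ?thesis by (simp add: face_of_linear_image[OF lin_h inj_h])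
    qed
    fix D E assume "D \<in> projected_envelope G" "E \<in> projected_envelope G"
    then show "D \<inter> E face_of D" "D \<inter> E face_of E"
      using meet[of D E] meet[of E D] by (simp_all add: Int_commute)
  qed
  moreover have "\<Union>(projected_envelope G) = K"
  proof
    show "\<Union>(projected_envelope G) \<subseteq> K"
    proof
      fix c assume "c \<in> \<Union>(projected_envelope G)"
      then obtain F where "F \<in> lower_envelope G" "c \<in> fst ` F"
        by (auto simp: projected_envelope_def)
      then have "F \<subseteq> G" by (simp add: lower_envelope_def face_of_imp_subset)
      then have "c \<in> fst ` G" using \<open>c \<in> fst ` F\<close> by blast
      then show "c \<in> K" by (auto simp: G_def)
    qed
    show "K \<subseteq> \<Union>(projected_envelope G)"
    proof
      fix c assume c: "c \<in> K"
      obtain a where a: "a \<in> J" "f c = c \<bullet> a" using f_attained by blast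
      define F where "F = G \<inter> {x. (- a, 1) \<bullet> x = 0}"
      have "F face_of G"
        unfolding F_def
      proof (rule face_of_Int_supporting_hyperplane_ge)
        show "convex G" using poly_G by (rule polyhedron_imp_convex)
        fix x assume "x \<in> G"
        then show "0 \<le> (- a, 1) \<bullet> x"
          using a(1) by (auto simp: G_def inner_commute)
      qed
      moreover have c_F: "(c, f c) \<in> F"
        using c a(2) by (simp add: F_def mem_G inner_commute)
      moreover have "t \<le> t'" if "(d, t) \<in> F" "(d, t') \<in> G" for d t t'
        using that a(1) by (auto simp: F_def G_def inner_commute)
      ultimately have "F \<in> lower_envelope G"
        by (auto simp: lower_envelope_def)
      moreover have "c \<in> fst ` F" using c_F by force
      ultimately show "c \<in> \<Union>(projected_envelope G)"
        by (auto simp: projected_envelope_def)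
    qed
  qed
  ultimately show "polyhedral_subdivision (projected_envelope G) K"
    by (simp add: polyhedral_subdivision_def)
qed

section \<open>The gap on a maximal cone\<close>

text \<open>What a maximal cone of the Groebner fan contributes to the gap formula.\<close>

locale groebner_cone =
  fixes A :: "int ^ 'n ^ 'd" and K :: "(real ^ 'n) set" and M :: "(('n \<Rightarrow>\<^sub>0 nat) \<Rightarrow>\<^sub>0 real) set"
  assumes convex_K: "convex K" and interior_K: "interior K \<noteq> {}"
    and ideal_K: "\<And>c. c \<in> interior K \<Longrightarrow> nonopt_ideal A c = M"
    and bounded_K: "\<And>c. c \<in> K \<Longrightarrow> recession_nonneg A c UNIV"
begin

lemma standard_iff: "c \<in> interior K \<Longrightarrow> ip_optimal A c w \<longleftrightarrow> monomial w \<notin> M"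
  using monomial_mem_nonopt_ideal[of w A c] ideal_K by simp

text \<open>Optimality is a closed condition on the cost, so it persists on the boundary of \<open>K\<close>, where further exponents may become optimal.\<close>

lemma standard_optimal:
  assumes "monomial w \<notin> M" "c \<in> K"
  shows "ip_optimal A c w"
  unfolding ip_optimal_def
proof
  fix v assume v: "v \<in> ip_feasible A (A *v int_vec w)"
  show "c \<bullet> real_vec (int_vec w) \<le> c \<bullet> real_vec v"
  proof (rule le_on_full_dimensional_convex[OF convex_K interior_K _ assms(2)])
    fix c' assume "c' \<in> interior K"
    then have "ip_optimal A c' w" using standard_iff assms(1) by simp
    then show "c' \<bullet> real_vec (int_vec w) \<le> c' \<bullet> real_vec v"
      using v by (simp add: ip_optimal_def)
  qed
qed

lemma M_generated: "\<exists>S. M = generated_ideal (monomial ` S)"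
proof -
  obtain c where "c \<in> interior K" using interior_K by blast
  then have "M = nonopt_ideal A c" by (simp add: ideal_K)
  then show ?thesis unfolding nonopt_ideal_def by (rule exI)
qed

lemma finite_components: "finite (irr_components M)"
  using M_generated by (elim exE) (simp add: finite_irr_components)

lemma standard_iff_component:
  "monomial w \<notin> M \<longleftrightarrow>
    (\<exists>(u, \<tau>)\<in>irr_components M. \<forall>i\<in>\<tau>. Poly_Mapping.lookup w i \<le> Poly_Mapping.lookup u i)"
  using M_generated by (elim exE) (simp only: irr_components_standard)

lemma push_standard:
  assumes "(u, \<tau>) \<in> irr_components M"
  shows "monomial (push u \<tau> m) \<notin> M"
  unfolding standard_iff_component using assms by (intro bexI[of _ "(u, \<tau>)"]) auto

lemma components_nonempty: "irr_components M \<noteq> {}"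
proof -
  obtain c where c: "c \<in> interior K" using interior_K by blast
  then have "c \<in> K" using interior_subset by blast
  then have "ip_optimal A c 0"
    using bounded_K[of c] unfolding recession_nonneg_iff_optimal by auto
  then show ?thesis
    using standard_iff[OF c, of 0] standard_iff_component[of 0] by auto
qed

text \<open>All \<open>push u \<tau> m\<close> are optimal, so the program of the component is bounded and has an optimal solution
  for one interior cost; this solution serves all interior costs and is the only one to do so.\<close>

lemma opt_vertex_optimal:
  assumes comp: "(u, \<tau>) \<in> irr_components M" and c: "c \<in> interior K"
  shows "relaxed_optimal A c u \<tau> (opt_vertex A K u \<tau>)"
proof -
  obtain c0 where c0: "c0 \<in> interior K" using interior_K by blast
  have "recession_nonneg A c0 \<tau>"
    by (rule recession_nonneg_if_push_optimal[of A c0 u]) (simp add: push_standard[OF comp] standard_iff[OF c0])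
  then have "\<exists>v. relaxed_optimal A c0 u \<tau> v"
    using lp_attains_minimum[of A c0 \<tau> "real_vec (int_vec u)" "real_mat A *v real_vec (int_vec u)"]
    by (simp add: relaxed_optimal_def relaxed_feasible_def)
  then obtain v where "relaxed_optimal A c0 u \<tau> v" ..
  then have v: "relaxed_optimal A c u \<tau> v" if "c \<in> interior K" for c
    using standard_iff[OF c0] standard_iff[OF that] by (intro relaxed_optimal_transfer[of A c0 c]) simp_all
  have "\<exists>!v. \<forall>c\<in>interior K. relaxed_optimal A c u \<tau> v"
  proof (rule ex1I[of _ v])
    show "\<forall>c\<in>interior K. relaxed_optimal A c u \<tau> v" using v by blast
    show "v' = v" if "\<forall>c\<in>interior K. relaxed_optimal A c u \<tau> v'" for v'
      using that v by (intro relaxed_optimal_unique[OF open_interior interior_K]) blast+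
  qed
  then have "\<forall>c\<in>interior K. relaxed_optimal A c u \<tau> (opt_vertex A K u \<tau>)"
    unfolding opt_vertex_def by (rule theI')
  then show ?thesis using c by blast
qed

definition offset :: "('n \<Rightarrow>\<^sub>0 nat) \<times> 'n set \<Rightarrow> real ^ 'n" where
  "offset = (\<lambda>(u, \<tau>). real_vec (int_vec u) - opt_vertex A K u \<tau>)"

lemma opt_vertex_feasible:
  "(u, \<tau>) \<in> irr_components M \<Longrightarrow> opt_vertex A K u \<tau> \<in> relaxed_feasible A u \<tau>"
  using opt_vertex_optimal[of u \<tau>] interior_K by (auto simp: relaxed_optimal_def)

text \<open>The optimal solution \<open>w\<close> of the integer program lies in the box of some component \<open>(u, \<tau>)\<close>, and
  translation by \<open>u - w\<close> embeds the relaxation into the program of that component.\<close>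

lemma gap_le_component:
  assumes c: "c \<in> K" and b: "ip_feasible_bounded A c b"
  shows "\<exists>k\<in>irr_components M. ip_value A c b - lp_value A c b \<le> c \<bullet> offset k"
proof -
  \<comment> \<open>An optimal solution for an interior cost is standard and so remains optimal for \<open>c\<close>, whereas
    one chosen for a boundary cost \<open>c\<close> might have its monomial in \<open>M\<close>.\<close>
  obtain c0 where c0: "c0 \<in> interior K" using interior_K by blast
  then have "recession_nonneg A c0 UNIV" using bounded_K interior_subset by blast
  then obtain w where w: "int_vec w \<in> ip_feasible A b" "ip_optimal A c0 w"
    using ip_attains_minimum[of A c0 b] b by (auto simp: ip_feasible_bounded_def)
  have std: "monomial w \<notin> M" using w(2) standard_iff[OF c0] by simp
  then obtain u \<tau> where comp: "(u, \<tau>) \<in> irr_components M"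
    and below: "\<forall>i\<in>\<tau>. Poly_Mapping.lookup w i \<le> Poly_Mapping.lookup u i"
    using standard_iff_component by auto
  let ?u = "real_vec (int_vec u)" and ?w = "real_vec (int_vec w)" and ?v = "opt_vertex A K u \<tau>"
  have Aw: "A *v int_vec w = b" using w(1) by (simp add: ip_feasible_def)
  have "c \<bullet> ?w - c \<bullet> offset (u, \<tau>) \<le> c \<bullet> x" if x: "x \<in> lp_feasible A b" for x
  proof -
    have shifted: "x + (?u - ?w) \<in> relaxed_feasible A u \<tau>"
      using x below Aw
      by (simp add: relaxed_feasible_def lp_feasible_def matrix_vector_right_distrib
          matrix_vector_mult_diff_distrib real_mat_real_vec add_nonneg_nonneg)
    have "c \<bullet> ?v \<le> c \<bullet> (x + (?u - ?w))"
    proof (rule le_on_full_dimensional_convex[OF convex_K interior_K _ c])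
      fix c' assume "c' \<in> interior K"
      then show "c' \<bullet> ?v \<le> c' \<bullet> (x + (?u - ?w))"
        using opt_vertex_optimal[OF comp, of c'] shifted by (simp add: relaxed_optimal_def)
    qed
    then show ?thesis by (simp add: offset_def inner_diff_right inner_add_right)
  qed
  moreover have "?w \<in> lp_feasible A b"
    using w(1) by (auto simp: lp_feasible_def ip_feasible_def real_mat_real_vec)
  ultimately have "c \<bullet> ?w - c \<bullet> offset (u, \<tau>) \<le> lp_value A c b"
    unfolding lp_value_def by (intro cINF_greatest) auto
  moreover have "ip_value A c b = c \<bullet> ?w"
    using ip_value_attained(1)[OF w(1) standard_optimal[OF std c]] .
  ultimately have "ip_value A c b - lp_value A c b \<le> c \<bullet> offset (u, \<tau>)" by simp
  then show ?thesis using comp by blast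
qed

text \<open>Adding \<open>m\<close> to the coordinates outside \<open>\<tau>\<close> of both \<open>u\<close> and the vertex does not change their
  difference. For large \<open>m\<close> the shifted vertex is feasible for the relaxation, and the shifted
  \<open>u\<close> is optimal for every \<open>m\<close>.\<close>

lemma component_le_gap:
  assumes c: "c \<in> K" and comp: "(u, \<tau>) \<in> irr_components M"
  shows "\<exists>b. ip_feasible_bounded A c b \<and> c \<bullet> offset (u, \<tau>) \<le> ip_value A c b - lp_value A c b"
proof -
  let ?v = "opt_vertex A K u \<tau>"
  define m where "m = nat \<lceil>\<Sum>i\<in>UNIV. \<bar>?v $ i\<bar>\<rceil>"
  have m: "0 \<le> ?v $ i + real m" for i
  proof -
    have "\<bar>?v $ i\<bar> \<le> (\<Sum>i\<in>UNIV. \<bar>?v $ i\<bar>)" by (rule member_le_sum) simp_all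
    also have "\<dots> \<le> real m" unfolding m_def by (rule real_nat_ceiling_ge)
    finally show ?thesis by linarith
  qed
  define w where "w = push u \<tau> m"
  define b where "b = A *v int_vec w"
  define x where "x = ?v + (real_vec (int_vec w) - real_vec (int_vec u))"
  have "int_vec w \<in> ip_feasible A b" by (simp add: b_def ip_feasible_def)
  moreover have "ip_optimal A c w"
    unfolding w_def by (rule standard_optimal[OF push_standard[OF comp] c])
  ultimately have ip: "ip_value A c b = c \<bullet> real_vec (int_vec w)" "ip_feasible_bounded A c b"
    by (rule ip_value_attained)+
  have x: "x \<in> lp_feasible A b"
    using opt_vertex_feasible[OF comp] m
    by (auto simp: lp_feasible_def relaxed_feasible_def x_def b_def w_def matrix_vector_right_distrib
        matrix_vector_mult_diff_distrib real_mat_real_vec)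
  then obtain v where "\<And>y. y \<in> lp_feasible A b \<Longrightarrow> c \<bullet> v \<le> c \<bullet> y"
    using lp_attains_minimum[OF bounded_K[OF c], of x "real_vec b"] by (auto simp: lp_feasible_def)
  then have "bdd_below ((\<lambda>x. c \<bullet> x) ` lp_feasible A b)"
    by (rule bdd_belowI2)
  then have "lp_value A c b \<le> c \<bullet> x"
    unfolding lp_value_def using x by (rule cINF_lower)
  then have "c \<bullet> offset (u, \<tau>) \<le> ip_value A c b - lp_value A c b"
    by (simp add: ip(1) x_def offset_def inner_add_right inner_diff_right)
  then show ?thesis using ip(2) by blast
qed

lemma gap_eq_max:
  assumes c: "c \<in> K"
  shows "gap A c = Max ((\<bullet>) c ` offset ` irr_components M)"
proof -
  let ?V = "(\<bullet>) c ` offset ` irr_components M"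
  have fin: "finite ?V" "?V \<noteq> {}" using finite_components components_nonempty by auto
  have le: "ip_value A c b - lp_value A c b \<le> Max ?V" if b: "ip_feasible_bounded A c b" for b
  proof -
    obtain k where k: "k \<in> irr_components M" "ip_value A c b - lp_value A c b \<le> c \<bullet> offset k"
      using gap_le_component[OF c b] by blast
    have "c \<bullet> offset k \<le> Max ?V" using k(1) fin(1) by (intro Max_ge) auto
    then show ?thesis using k(2) by linarith
  qed
  have "Max ?V \<in> ?V" using fin by (rule Max_in)
  then obtain k where "k \<in> irr_components M" "Max ?V = c \<bullet> offset k" by blast
  then obtain u \<tau> where k: "(u, \<tau>) \<in> irr_components M" "Max ?V = c \<bullet> offset (u, \<tau>)"
    by (cases k) simp
  obtain b where b: "ip_feasible_bounded A c b" "Max ?V \<le> ip_value A c b - lp_value A c b"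
    using component_le_gap[OF c k(1)] unfolding k(2) by blast
  have attained: "Max ?V = ip_value A c b - lp_value A c b" using le[OF b(1)] b(2) by (rule antisym[rotated])
  then show ?thesis
    unfolding gap_def
  proof (intro Greatest_equality)
    show "\<exists>b. ip_feasible_bounded A c b \<and> Max ?V = ip_value A c b - lp_value A c b"
      using b(1) attained by (intro exI[of _ b] conjI)
    show "g \<le> Max ?V" if "\<exists>b. ip_feasible_bounded A c b \<and> g = ip_value A c b - lp_value A c b" for g
      using that le by (elim exE conjE) simp
  qed
qed

lemma gap_cone_eq: "gap_cone A K M = {(c, t). c \<in> K \<and> (\<forall>a\<in>offset ` irr_components M. c \<bullet> a \<le> t)}"
  by (auto simp: gap_cone_def offset_def)

end

theorem theorem5p1:
  fixes A :: "int ^ 'n ^ 'd"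
    and \<F> :: "(real ^ 'n) set set"
    and K :: "(real ^ 'n) set"
    and M :: "(('n \<Rightarrow>\<^sub>0 nat) \<Rightarrow>\<^sub>0 real) set"
  assumes "is_groebner_fan A \<F>"
    and "maximal_cone K \<F>"
    and "\<forall>c\<in>interior K. nonopt_ideal A c = M"
    and "M \<noteq> UNIV"
  shows "polyhedral_subdivision (projected_envelope (gap_cone A K M)) K \<and>
    (\<forall>D\<in>projected_envelope (gap_cone A K M).
       \<exists>l :: real ^ 'n \<Rightarrow> real. linear l \<and> (\<forall>c\<in>D. gap A c = l c))"
proof -
  have cpx: "polyhedral_complex \<F>" and supp: "\<Union>\<F> = {c. recession_nonneg A c UNIV}"
    using assms(1)
    by (simp_all add: is_groebner_fan_def constant_ideal_fan_def polyhedral_fan_def nonopt_ideal_eq_UNIV_iff)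
  have K: "K \<in> \<F>" "\<And>C. C \<in> \<F> \<Longrightarrow> K \<subseteq> C \<Longrightarrow> C = K"
    using assms(2) by (auto simp: maximal_cone_def)
  have "polyhedron K" using cpx K(1) by (simp add: polyhedral_complex_def)
  have "interior K \<noteq> {}"
  proof (rule maximal_cell_full_dimensional[OF cpx])
    show "convex (\<Union>\<F>)" "interior (\<Union>\<F>) \<noteq> {}"
      unfolding supp by (rule convex_bounded_costs interior_bounded_costs)+
  qed (fact K)+
  interpret groebner_cone A K M
  proof
    show "convex K" using \<open>polyhedron K\<close> by (rule polyhedron_imp_convex)
    show "interior K \<noteq> {}" by fact
    show "nonopt_ideal A c = M" if "c \<in> interior K" for c using assms(3) that by blast
    show "recession_nonneg A c UNIV" if "c \<in> K" for c using supp K(1) that by blast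
  qed
  let ?J = "offset ` irr_components M"
  have J: "finite ?J" "?J \<noteq> {}" using finite_components components_nonempty by auto
  note env = projected_envelope_max[OF \<open>polyhedron K\<close> J, folded gap_cone_eq]
  have "\<exists>l :: real ^ 'n \<Rightarrow> real. linear l \<and> (\<forall>c\<in>D. gap A c = l c)"
    if D: "D \<in> projected_envelope (gap_cone A K M)" for D
  proof -
    from env(2)[OF D] obtain a where a: "\<forall>c\<in>D. Max ((\<bullet>) c ` ?J) = c \<bullet> a"
      by (elim bexE)
    have "D \<subseteq> K" using env(1) D unfolding polyhedral_subdivision_def by blast
    have "gap A c = c \<bullet> a" if "c \<in> D" for c
      using gap_eq_max[of c] a that \<open>D \<subseteq> K\<close> by (simp add: subset_iff)
    then have "\<forall>c\<in>D. gap A c = c \<bullet> a" by blast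
    moreover have "linear (\<lambda>c. c \<bullet> a)" by (simp add: bounded_linear_inner_left bounded_linear.linear)
    ultimately show ?thesis by blast
  qed
  then show ?thesis using env(1) by blast
qed

end
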